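(* Let $\alpha$ be an ordinal with $3\le\alpha<\varepsilon_0$ and $A,B$ two languages. If $A\le_T^{\mathscr F_{<\alpha}}B$ and $B\in\mathbf F_\alpha$, then $A\in\mathbf F_\alpha$.
   Context: Ordinals are below $\varepsilon_0$ in Cantor normal form; limit ordinals have fundamental sequences $(\gamma+\omega^{\beta+1})(x)=\gamma+\omega^\beta\cdot(x+1)$, $(\gamma+\omega^{\lambda'})(x)=\gamma+\omega^{\lambda'(x)}$ for $\lambda'$ limit. Fast-growing functions: $F_0(x)=x+1$, $F_{\alpha+1}(x)=F_\alpha^{x+1}(x)$, $F_\lambda(x)=F_{\lambda(x)}(x)$. Extended Grzegorczyk class $\mathscr F_\alpha$: smallest class of functions $\mathbb N^k\to\mathbb N$ containing the zero function, addition, projections and $F_\alpha$, closed under composition and limited primitive recursion (primitive recursion bounded by some function of the class applied to the max of the arguments). $\mathscr F_{<\alpha}=\bigcup_{\beta<\alpha}\mathscr F_\beta$. $\mathrm{DTime}(t(n))$: languages decided by a deterministic Turing machine in at most $t(n)$ steps on inputs of length $n$. $\mathbf F_\alpha=\bigcup_{p\in\mathscr F_{<\alpha}}\mathrm{DTime}(F_\alpha(p(n)))$ ($p$ unary). Turing reductions: $A\le_T^f B$ if there is an oracle Turing machine with oracle $B$ deciding $A$ in deterministic time $f(n)$; $A\le_T^{\mathcal C}B$ if $A\le_T^f B$ for some $f\in\mathcal C$. *)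

theory Defs
  imports Main
begin

section \<open>Ordinals below \<open>\<epsilon>\<^sub>0\<close>\<close>

text \<open>\<open>W a b\<close> stands for \<open>\<omega>\<^sup>a + b\<close>, so a term is a finite formal sum
  of powers of \<open>\<omega>\<close>; the ordinals below \<open>\<epsilon>\<^sub>0\<close> are the terms in Cantor normal form,
  singled out by \<open>normal\<close>.\<close>

datatype cnf = Zero | W cnf cnf

instantiation cnf :: linorder
begin

fun less_cnf :: "cnf \<Rightarrow> cnf \<Rightarrow> bool" where
  "less_cnf _ Zero = False"
| "less_cnf Zero (W _ _) = True"
| "less_cnf (W a b) (W c d) = (less_cnf a c \<or> (a = c \<and> less_cnf b d))"

definition less_eq_cnf :: "cnf \<Rightarrow> cnf \<Rightarrow> bool" where
  "less_eq_cnf a b \<longleftrightarrow> a < b \<or> a = b"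

instance
proof
  fix x y z :: cnf
  have irr: "\<not> a < a" for a :: cnf by (induction a) auto
  have tr: "a < b \<Longrightarrow> b < c \<Longrightarrow> a < c" for a b c :: cnf
  proof (induction a c arbitrary: b rule: less_cnf.induct)
    case (1 a) then show ?case by simp
  next
    case (2 c d) then show ?case by simp
  next
    case (3 a b c d e)
    from "3.prems"(1) obtain u v where "e = W u v" by (cases e) auto
    then show ?case using 3 by auto
  qed
  have tot: "a < b \<or> a = b \<or> b < a" for a b :: cnf
    by (induction a b rule: less_cnf.induct) (auto, metis less_cnf.simps cnf.exhaust)
  show "(x < y) = (x \<le> y \<and> \<not> y \<le> x)"
    using irr tr by (auto simp: less_eq_cnf_def)
  show "x \<le> x" by (simp add: less_eq_cnf_def)
  show "x \<le> y \<Longrightarrow> y \<le> z \<Longrightarrow> x \<le> z" using tr by (auto simp: less_eq_cnf_def)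
  show "x \<le> y \<Longrightarrow> y \<le> x \<Longrightarrow> x = y" using irr tr by (auto simp: less_eq_cnf_def)
  show "x \<le> y \<or> y \<le> x" using tot by (auto simp: less_eq_cnf_def)
qed

end

fun normal :: "cnf \<Rightarrow> bool" where
  "normal Zero = True"
| "normal (W a Zero) = normal a"
| "normal (W a (W c d)) = (c \<le> a \<and> normal a \<and> normal (W c d))"

definition fin :: "nat \<Rightarrow> cnf" where
  "fin n = (W Zero ^^ n) Zero"

fun is_succ :: "cnf \<Rightarrow> bool" where
  "is_succ Zero = False"
| "is_succ (W a Zero) = (a = Zero)"
| "is_succ (W a (W c d)) = is_succ (W c d)"

text \<open>\<open>pred\<close> is only meaningful on successors, and \<open>fs\<close> only on limits, i.e. on
  nonzero terms that are not successors.\<close>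

fun pred :: "cnf \<Rightarrow> cnf" where
  "pred Zero = Zero"
| "pred (W a Zero) = Zero"
| "pred (W a (W c d)) = W a (pred (W c d))"

fun fs :: "cnf \<Rightarrow> nat \<Rightarrow> cnf" where
  "fs Zero x = Zero"
| "fs (W a Zero) x = (if is_succ a then (W (pred a) ^^ (x + 1)) Zero else W (fs a x) Zero)"
| "fs (W a (W c d)) x = W a (fs (W c d) x)"

section \<open>Fast-growing functions\<close>

definition descent :: "(cnf \<times> cnf) set" where
  "descent = {(b, a). a \<noteq> Zero \<and> (if is_succ a then b = pred a else (\<exists>x. b = fs a x))}"

fun app :: "cnf \<Rightarrow> cnf \<Rightarrow> cnf" where
  "app Zero t = t"
| "app (W a b) t = W a (app b t)"

lemma app_Zero [simp]: "app g Zero = g"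
  by (induction g) auto

lemma app_assoc: "app (app g h) t = app g (app h t)"
  by (induction g) auto

lemma app_nonzero: "t \<noteq> Zero \<Longrightarrow> app g t \<noteq> Zero"
  by (cases g) auto

lemma app_last:
  assumes "t \<noteq> Zero"
  shows "is_succ (app g t) = is_succ t" "pred (app g t) = app g (pred t)"
    "fs (app g t) x = app g (fs t x)"
proof -
  have "is_succ (app g t) = is_succ t \<and> pred (app g t) = app g (pred t)
    \<and> fs (app g t) x = app g (fs t x)"
  proof (induction g)
    case (W a b)
    obtain c d where "app b t = W c d"
      using app_nonzero[OF assms] by (meson cnf.exhaust)
    then show ?case using W.IH(2) by simp
  qed simp
  then show "is_succ (app g t) = is_succ t" "pred (app g t) = app g (pred t)"
    "fs (app g t) x = app g (fs t x)" by auto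
qed

lemma app_funpow: "app g ((W b ^^ n) (W b Zero)) = ((\<lambda>h. app h (W b Zero)) ^^ Suc n) g"
proof (induction n arbitrary: g)
  case (Suc n)
  have "app g ((W b ^^ Suc n) (W b Zero))
      = app (app g (W b Zero)) ((W b ^^ n) (W b Zero))"
    by (simp add: app_assoc)
  also have "\<dots> = ((\<lambda>h. app h (W b Zero)) ^^ Suc n) (app g (W b Zero))"
    by (rule Suc.IH)
  also have "\<dots> = ((\<lambda>h. app h (W b Zero)) ^^ Suc (Suc n)) g"
    by (simp only: funpow_Suc_right o_apply)
  finally show ?case .
qed simp

lemma acc_omega:
  assumes "b \<in> Wellfounded.acc descent" "g \<in> Wellfounded.acc descent"
  shows "app g (W b Zero) \<in> Wellfounded.acc descent"
  using assms
proof (induction b arbitrary: g rule: acc.induct)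
  case (accI b)
  show ?case
  proof (rule acc.accI)
    fix y assume "(y, app g (W b Zero)) \<in> descent"
    then have y: "if b = Zero then y = g
        else (\<exists>x. y = app g (fs (W b Zero) x))"
      by (auto simp: descent_def app_last split: if_splits)
    show "y \<in> Wellfounded.acc descent"
    proof (cases "b = Zero")
      case True then show ?thesis using y accI.prems by simp
    next
      case False
      then obtain x where x: "y = app g (fs (W b Zero) x)" using y by auto
      show ?thesis
      proof (cases "is_succ b")
        case True
        have "(pred b, b) \<in> descent" using False True by (simp add: descent_def)
        then have "((\<lambda>h. app h (W (pred b) Zero)) ^^ n) g \<in> Wellfounded.acc descent" for n
          by (induction n) (auto simp: accI)
        from this[of "Suc x"] show ?thesis
          using x True app_funpow[of g x "pred b"] by (simp add: funpow_swap1)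
      next
        case nonsucc: False
        have "(fs b x, b) \<in> descent" using False nonsucc by (auto simp: descent_def)
        then show ?thesis using x nonsucc accI by simp
      qed
    qed
  qed
qed

lemma acc_app: "g \<in> Wellfounded.acc descent \<Longrightarrow> app g t \<in> Wellfounded.acc descent"
proof (induction t arbitrary: g)
  case (W a b)
  have "Zero \<in> Wellfounded.acc descent" by (rule acc.accI) (simp add: descent_def)
  then have "a \<in> Wellfounded.acc descent" using W.IH(1)[of Zero] by simp
  then show ?case
    using W.IH(2)[OF acc_omega[OF _ W.prems]] by (simp add: app_assoc)
qed simp

lemma wf_descent: "wf descent"
proof (rule acc_wfI, rule allI)
  fix t
  have "Zero \<in> Wellfounded.acc descent" by (rule acc.accI) (simp add: descent_def)
  then show "t \<in> Wellfounded.acc descent" using acc_app[of Zero t] by simp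
qed

function F :: "cnf \<Rightarrow> nat \<Rightarrow> nat" where
  "F a x = (if a = Zero then x + 1
            else if is_succ a then (F (pred a) ^^ (x + 1)) x
            else F (fs a x) x)"
  by pat_completeness auto
termination
  by (relation "inv_image descent fst") (rule wf_inv_image[OF wf_descent], auto simp: descent_def)

declare F.simps [simp del]

section \<open>Extended Grzegorczyk classes\<close>

text \<open>\<open>grz a k f\<close>: the function \<open>f\<close> from \<open>\<nat>\<^sup>k\<close> to \<open>\<nat>\<close> is in the class of \<open>a\<close>.
  Tuples are lists of length \<open>k\<close>, and the values of \<open>f\<close> on other lists are irrelevant (rule \<open>grz_ext\<close>).\<close>

inductive grz :: "cnf \<Rightarrow> nat \<Rightarrow> (nat list \<Rightarrow> nat) \<Rightarrow> bool" for a :: cnf where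
  grz_zero: "grz a k (\<lambda>xs. 0)"
| grz_add: "grz a 2 (\<lambda>xs. xs ! 0 + xs ! 1)"
| grz_proj: "i < k \<Longrightarrow> grz a k (\<lambda>xs. xs ! i)"
| grz_fast: "grz a 1 (\<lambda>xs. F a (xs ! 0))"
| grz_comp: "grz a (length gs) h \<Longrightarrow> (\<forall>g \<in> set gs. grz a k g) \<Longrightarrow>
    grz a k (\<lambda>xs. h (map (\<lambda>g. g xs) gs))"
| grz_limrec: "grz a k g \<Longrightarrow> grz a (k + 2) h \<Longrightarrow> grz a 1 b \<Longrightarrow>
    (\<forall>xs. length xs = k \<longrightarrow> f (0 # xs) = g xs) \<Longrightarrow>
    (\<forall>n xs. length xs = k \<longrightarrow> f (Suc n # xs) = h (n # f (n # xs) # xs)) \<Longrightarrow>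
    (\<forall>n xs. length xs = k \<longrightarrow> f (n # xs) \<le> b [Max (set (n # xs))]) \<Longrightarrow>
    grz a (k + 1) f"
| grz_ext: "grz a k f \<Longrightarrow> (\<forall>xs. length xs = k \<longrightarrow> f' xs = f xs) \<Longrightarrow> grz a k f'"

definition grz_below :: "cnf \<Rightarrow> (nat \<Rightarrow> nat) set" where
  "grz_below a = {p. \<exists>b<a. normal b \<and> grz b 1 (\<lambda>xs. p (xs ! 0))}"

section \<open>Deterministic Turing machines\<close>

text \<open>Multi-tape machines with two-way infinite tapes. A tape is given by its contents and
  its head position; all heads start on cell 0, the input is on tape 0, and the other tapes are
  blank. The field \<open>letter\<close> embeds the input alphabet into the tape alphabet.\<close>

datatype move = Left | Stay | Right

fun shift :: "move \<Rightarrow> int" where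
  "shift Left = -1" | "shift Stay = 0" | "shift Right = 1"

record ('a, 'q, 's) tm =
  states :: "'q set"
  symbols :: "'s set"
  ntapes :: nat
  blank :: 's
  letter :: "'a \<Rightarrow> 's"
  start :: 'q
  accept :: 'q
  reject :: 'q
  delta :: "'q \<Rightarrow> 's list \<Rightarrow> 'q \<times> ('s \<times> move) list"

definition wf_tm :: "('a, 'q, 's, 'z) tm_scheme \<Rightarrow> bool" where
  "wf_tm M \<longleftrightarrow>
     finite (states M) \<and> finite (symbols M) \<and> 1 \<le> ntapes M \<and>
     blank M \<in> symbols M \<and> inj (letter M) \<and> range (letter M) \<subseteq> symbols M - {blank M} \<and>
     {start M, accept M, reject M} \<subseteq> states M \<and> accept M \<noteq> reject M \<and>
     (\<forall>q ss. q \<in> states M \<and> set ss \<subseteq> symbols M \<and> length ss = ntapes M \<longrightarrow>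
        (case delta M q ss of (q', acts) \<Rightarrow>
           q' \<in> states M \<and> length acts = ntapes M \<and> fst ` set acts \<subseteq> symbols M))"

type_synonym 's tape = "(int \<Rightarrow> 's) \<times> int"
type_synonym ('q, 's) config = "'q \<times> 's tape list"

definition init :: "('a, 'q, 's, 'z) tm_scheme \<Rightarrow> 'a list \<Rightarrow> ('q, 's) config" where
  "init M w = (start M,
     (\<lambda>i. if 0 \<le> i \<and> i < int (length w) then letter M (w ! nat i) else blank M, 0)
     # replicate (ntapes M - 1) (\<lambda>i. blank M, 0))"

fun act :: "'s \<times> move \<Rightarrow> 's tape \<Rightarrow> 's tape" where
  "act (s, d) (t, h) = (t(h := s), h + shift d)"

fun step :: "('a, 'q, 's, 'z) tm_scheme \<Rightarrow> ('q, 's) config \<Rightarrow> ('q, 's) config" where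
  "step M (q, ts) =
     (if q = accept M \<or> q = reject M then (q, ts)
      else case delta M q (map (\<lambda>(t, h). t h) ts) of (q', acts) \<Rightarrow> (q', map2 act acts ts))"

definition DTime :: "(nat \<Rightarrow> nat) \<Rightarrow> 'a list set set" where
  "DTime t = {L. \<exists>M :: ('a, nat, nat) tm. wf_tm M \<and>
     (\<forall>w. \<exists>m \<le> t (length w).
        fst ((step M ^^ m) (init M w)) = (if w \<in> L then accept M else reject M))}"

definition FF :: "cnf \<Rightarrow> 'a list set set" where
  "FF a = (\<Union>p \<in> grz_below a. DTime (\<lambda>n. F a (p n)))"

section \<open>Oracle machines and Turing reductions\<close>

text \<open>Tape 1 is the query tape. In state \<open>query\<close> the machine moves in one step to
  \<open>yes\<close> or \<open>no\<close>, leaving all tapes unchanged. The queried word is the longest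
  word over the oracle alphabet (embedded by \<open>oletter\<close>) written on the query tape from cell 0 on.\<close>

record ('a, 'b, 'q, 's) otm = "('a, 'q, 's) tm" +
  oletter :: "'b \<Rightarrow> 's"
  query :: 'q
  yes :: 'q
  no :: 'q

definition wf_otm :: "('a, 'b, 'q, 's) otm \<Rightarrow> bool" where
  "wf_otm M \<longleftrightarrow> wf_tm M \<and> 2 \<le> ntapes M \<and>
     inj (oletter M) \<and> range (oletter M) \<subseteq> symbols M - {blank M} \<and>
     {query M, yes M, no M} \<subseteq> states M \<and> distinct [accept M, reject M, query M] \<and> yes M \<noteq> no M"

definition queried :: "('a, 'b, 'q, 's) otm \<Rightarrow> (int \<Rightarrow> 's) \<Rightarrow> 'b list \<Rightarrow> bool" where
  "queried M t w \<longleftrightarrow> (\<forall>i < length w. t (int i) = oletter M (w ! i)) \<and>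
     t (int (length w)) \<notin> range (oletter M)"

fun ostep :: "'b list set \<Rightarrow> ('a, 'b, 'q, 's) otm \<Rightarrow> ('q, 's) config \<Rightarrow> ('q, 's) config" where
  "ostep B M (q, ts) =
     (if q = query M then (if \<exists>w \<in> B. queried M (fst (ts ! 1)) w then yes M else no M, ts)
      else step M (q, ts))"

definition turing_red :: "(nat \<Rightarrow> nat) \<Rightarrow> 'a list set \<Rightarrow> 'b list set \<Rightarrow> bool" where
  "turing_red f A B \<longleftrightarrow> (\<exists>M :: ('a, 'b, nat, nat) otm. wf_otm M \<and>
     (\<forall>w. \<exists>m \<le> f (length w).
        fst ((ostep B M ^^ m) (init M w)) = (if w \<in> A then accept M else reject M)))"

definition turing_red_class ::
    "(nat \<Rightarrow> nat) set \<Rightarrow> 'a list set \<Rightarrow> 'b list set \<Rightarrow> bool" where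
  "turing_red_class C A B \<longleftrightarrow> (\<exists>f \<in> C. turing_red f A B)"

end

theory Submission
  imports Defs "HOL-Library.Countable"
begin

text \<open>Let \<open>M\<close> be an oracle machine reducing \<open>A\<close> to \<open>B\<close> in time \<open>f\<close>, and let \<open>N\<close> decide \<open>B\<close> in time
  \<open>F\<^sub>\<alpha> \<circ> p\<close>. Answering every query of \<open>M\<close> by a run of \<open>N\<close> gives a machine for \<open>A\<close>. Both \<open>f\<close> and \<open>p\<close>
  are bounded by an iterate \<open>g\<close> of a single \<open>F\<^sub>\<delta>\<close> with \<open>2 \<le> \<delta> < \<alpha>\<close>, since \<open>F\<^sub>\<beta>\<close> is eventually
  below \<open>F\<^sub>\<delta>\<close> for \<open>\<beta> \<le> \<delta>\<close>; hence the running time is polynomial in \<open>F\<^sub>\<alpha> (g (g n))\<close>. Finally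
  \<open>F\<^sub>2 (F\<^sub>\<alpha> y) \<le> F\<^sub>\<alpha> (y + 1)\<close> for \<open>\<alpha> \<ge> 3\<close>, so that the polynomial is absorbed by enlarging the
  argument. Only upper bounds matter, so inclusions between the classes are never needed.\<close>

section \<open>The fast-growing hierarchy\<close>

text \<open>At a fixed argument \<open>F\<close> is not monotone in its index: at the argument 1 the
  index \<omega> gives a smaller value than the index 3. Even monotonicity in the argument is not
  obvious at limits, where the index moves along with it. Both points are settled by
  \<open>red x\<close>, the step-down relation that takes the member with index x of the fundamental
  sequence at every limit: along it values at arguments y \<ge> x can only decrease, and later
  members of a fundamental sequence step down to earlier ones. On the machine side the obstacle is
  that N is called many times, on two-way infinite tapes where neither cell 0 nor the used region
  can be sensed. With marks and a recognisable region to erase, a call costs time linear in the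
  query length, the position of the query head and the time of N. The first two are bounded by the
  time of M, which cannot write a query longer than its number of steps. Since f and p need not be
  monotone, they are replaced by iterates of one \<open>F\<close>, which are monotone and again
  yield members of \<open>grz_below\<close>.\<close>

definition red :: "nat \<Rightarrow> (cnf \<times> cnf) set" where
  "red x = {(a, b). a \<noteq> Zero \<and> b = (if is_succ a then pred a else fs a x)}"

lemma red_descent: "(a, b) \<in> red x \<Longrightarrow> (b, a) \<in> descent"
  by (auto simp: red_def descent_def)

lemma red_app: "(t, u) \<in> red x \<Longrightarrow> (app g t, app g u) \<in> red x"
  by (auto simp: red_def app_last app_nonzero split: if_splits)

lemma reds_app: "(t, u) \<in> (red x)\<^sup>* \<Longrightarrow> (app g t, app g u) \<in> (red x)\<^sup>*"
  by (induction rule: rtrancl_induct) (auto intro: red_app rtrancl_into_rtrancl)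

lemma reds_Zero: "(a, Zero) \<in> (red x)\<^sup>*"
proof (induction a rule: wf_induct_rule[OF wf_descent])
  case (1 a)
  show ?case
  proof (cases "a = Zero")
    case False
    then obtain b where "(a, b) \<in> red x" by (auto simp: red_def)
    then show ?thesis using 1[OF red_descent] by (meson converse_rtrancl_into_rtrancl)
  qed simp
qed

text \<open>Stepping down acts on the last summands only, so the tail \<open>t\<close> runs down to
  \<open>Zero\<close> while \<open>g\<close> stays.\<close>

lemma reds_drop: "(app g t, g) \<in> (red x)\<^sup>*"
  using reds_app[OF reds_Zero, of g t x] by simp

lemma W_funpow_add: "(W b ^^ (m + n)) Zero = app ((W b ^^ m) Zero) ((W b ^^ n) Zero)"
  by (induction m) auto

text \<open>At a successor exponent one step produces x + 1 copies of the smaller power, and all but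
  the first are dropped; at a limit exponent the step takes place in the exponent itself.\<close>

lemma red_W: assumes "(a, b) \<in> red x" shows "(W a Zero, W b Zero) \<in> (red x)\<^sup>*"
proof (cases "is_succ a")
  case True
  then have b: "a \<noteq> Zero" "b = pred a" using assms by (auto simp: red_def)
  have "(W a Zero, (W b ^^ (1 + x)) Zero) \<in> red x"
    using b True by (auto simp: red_def)
  moreover have "((W b ^^ (1 + x)) Zero, W b Zero) \<in> (red x)\<^sup>*"
    unfolding W_funpow_add using reds_drop[of "W b Zero"] by simp
  ultimately show ?thesis by (rule converse_rtrancl_into_rtrancl)
next
  case False
  then have "(W a Zero, W b Zero) \<in> red x" using assms by (auto simp: red_def)
  then show ?thesis by (rule r_into_rtrancl)
qed

lemma reds_W: "(a, b) \<in> (red x)\<^sup>* \<Longrightarrow> (W a Zero, W b Zero) \<in> (red x)\<^sup>*"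
  by (induction rule: rtrancl_induct) (auto dest: red_W)

text \<open>A form of the Bachmann property. At a successor exponent the later member is the earlier
  one followed by further summands, which are dropped; at other exponents the descent happens in the
  exponent.\<close>

lemma reds_fs: "x \<le> y \<Longrightarrow> (fs a y, fs a x) \<in> (red x)\<^sup>*"
proof (induction a y rule: fs.induct)
  case (2 a y)
  show ?case
  proof (cases "is_succ a")
    case True
    have "(W (pred a) ^^ (y + 1)) Zero = app ((W (pred a) ^^ (x + 1)) Zero) ((W (pred a) ^^ (y - x)) Zero)"
      using 2 W_funpow_add[of "x + 1" "y - x"] by simp
    then show ?thesis using True by (simp add: reds_drop del: funpow.simps)
  next
    case False
    then show ?thesis using 2 by (simp add: reds_W)
  qed
next
  case (3 a c d y)
  then show ?case using reds_app[of _ _ x "W a Zero"] by simp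
qed simp

section \<open>Monotonicity of \<open>F\<close> in its argument and along step-down chains\<close>

lemma F_Zero: "F Zero x = x + 1"
  by (simp add: F.simps)

lemma F_succ: "a \<noteq> Zero \<Longrightarrow> is_succ a \<Longrightarrow> F a x = (F (pred a) ^^ (x + 1)) x"
  by (subst F.simps) simp

lemma F_limit: "a \<noteq> Zero \<Longrightarrow> \<not> is_succ a \<Longrightarrow> F a x = F (fs a x) x"
  by (subst F.simps) simp

lemma funpow_mono_le:
  fixes g :: "nat \<Rightarrow> nat"
  assumes "mono g" "\<And>x. x < g x" "x \<le> y" "m \<le> n"
  shows "(g ^^ m) x \<le> (g ^^ n) y"
proof -
  have 1: "(g ^^ m) x \<le> (g ^^ m) y" using assms(1,3) by (simp add: funpow_mono)
  have "(g ^^ m) y \<le> (g ^^ (k + m)) y" for k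
  proof (induction k)
    case (Suc k)
    show ?case using Suc assms(2)[of "(g ^^ (k + m)) y"] by simp
  qed simp
  from this[of "n - m"] 1 show ?thesis using assms(4) by simp
qed

lemma funpow_gt:
  fixes g :: "nat \<Rightarrow> nat"
  assumes "\<And>x. x < g x"
  shows "x + n \<le> (g ^^ n) x"
proof (induction n)
  case (Suc n)
  then show ?case using assms[of "(g ^^ n) x"] by simp
qed simp

text \<open>The three claims need each other, hence a single induction. At a limit, monotonicity is
  \<open>F (fs a x) x \<le> F (fs a x) y \<le> F (fs a y) y\<close>, where the second inequality
  applies the third claim at every step of the chain from \<open>fs a y\<close> to
  \<open>fs a x\<close>. The members of that chain may lie many \<open>descent\<close> steps below
  \<open>a\<close>, so the induction is over the transitive closure.\<close>

lemma F_props: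
  "mono (F a) \<and> (\<forall>x. x < F a x) \<and> (\<forall>x y b. x \<le> y \<longrightarrow> (a, b) \<in> red x \<longrightarrow> F b y \<le> F a y)"
proof (induction a rule: wf_induct_rule[OF wf_trancl[OF wf_descent]])
  case (1 a)
  show ?case
  proof (cases "a = Zero")
    case True
    then show ?thesis by (auto simp: F_Zero mono_def red_def)
  next
    case nz: False
    show ?thesis
    proof (cases "is_succ a")
      case True
      have "(pred a, a) \<in> descent\<^sup>+" using nz True by (auto simp: descent_def)
      note IH = 1[OF this]
      have "mono (F a)"
        unfolding mono_def F_succ[OF nz True] using IH by (auto intro!: funpow_mono_le simp del: funpow.simps)
      moreover have "F (pred a) x \<le> F a x" for x
        unfolding F_succ[OF nz True] using IH funpow_mono_le[of "F (pred a)" x x 1 "x + 1"] by simp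
      ultimately show ?thesis using IH True by (auto simp: red_def intro: less_le_trans)
    next
      case False
      have lt: "(fs a x, a) \<in> descent" for x using nz False by (auto simp: descent_def)
      have chain: "F c y \<le> F (fs a y) y" if "(fs a y, c) \<in> (red x)\<^sup>*" "x \<le> y" for x y c
        using that(1)
      proof (induction rule: rtrancl_induct)
        case (step c d)
        have "(c, fs a y) \<in> descent\<^sup>*"
          using step(1)
          by (induction rule: rtrancl_induct) (auto intro: converse_rtrancl_into_rtrancl dest: red_descent)
        then have "(c, a) \<in> descent\<^sup>+" using lt by (rule rtrancl_into_trancl1)
        from 1[OF this] step that(2) show ?case by (meson order_trans)
      qed simp
      have ch: "F (fs a x) y \<le> F a y" if "x \<le> y" for x y
        using chain[OF reds_fs] that F_limit[OF nz False] by simp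
      have "mono (F a)"
      proof (rule monoI)
        fix x y :: nat assume xy: "x \<le> y"
        have "F a x \<le> F (fs a x) y"
          using 1[OF r_into_trancl[OF lt]] xy F_limit[OF nz False] by (auto simp: mono_def)
        with ch[OF xy] show "F a x \<le> F a y" by simp
      qed
      moreover have "x < F a x" for x
        using 1[OF r_into_trancl[OF lt]] F_limit[OF nz False] by auto
      ultimately show ?thesis using ch False by (auto simp: red_def)
    qed
  qed
qed

lemma F_mono: "mono (F a)" and F_gt: "x < F a x"
  and F_red: "x \<le> y \<Longrightarrow> (a, b) \<in> red x \<Longrightarrow> F b y \<le> F a y"
  using F_props by blast+

lemma F_le: "x \<le> y \<Longrightarrow> F a x \<le> F a y"
  using F_mono by (rule monoD)

section \<open>Order, predecessors and fundamental sequences\<close>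

lemma Zero_le [simp]: "Zero \<le> a"
  by (cases a) (auto simp: less_eq_cnf_def)

lemma pred_le: "pred a \<le> a"
  by (induction a rule: pred.induct) (auto simp: less_eq_cnf_def)

lemma is_succ_nonzero: "is_succ a \<Longrightarrow> a \<noteq> Zero"
  by auto

lemma normal_W: "normal (W a t) \<longleftrightarrow> normal a \<and> normal t \<and> (\<forall>c d. t = W c d \<longrightarrow> c \<le> a)"
  by (cases t) auto

lemma normal_pred: "normal a \<Longrightarrow> normal (pred a)"
proof (induction a rule: pred.induct)
  case (3 a c d)
  then show ?case by (cases d) (auto simp: normal_W)
qed auto

lemma W_le: "W a b \<le> W c d \<longleftrightarrow> a < c \<or> a = c \<and> b \<le> d"
  by (auto simp: less_eq_cnf_def)

lemma pred_less: "is_succ a \<Longrightarrow> pred a < a"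
  by (induction a rule: pred.induct) auto

lemma less_pred: "b < a \<Longrightarrow> is_succ a \<Longrightarrow> normal b \<Longrightarrow> b \<le> pred a"
proof (induction a arbitrary: b rule: pred.induct)
  case (2 a)
  then show ?case by (cases b) auto
next
  case (3 a c d)
  show ?case
  proof (cases b)
    case (W u v)
    then show ?thesis using 3 by (auto simp: W_le normal_W)
  qed simp
qed simp

lemma fs_nonzero: "a \<noteq> Zero \<Longrightarrow> \<not> is_succ a \<Longrightarrow> fs a x \<noteq> Zero"
  by (induction a x rule: fs.induct) auto

lemma fs_less: "a \<noteq> Zero \<Longrightarrow> \<not> is_succ a \<Longrightarrow> fs a x < a"
proof (induction a x rule: fs.induct)
  case (2 a x)
  then show ?case by (auto simp: pred_less)
qed auto

lemma normal_funpow: "normal b \<Longrightarrow> normal ((W b ^^ n) Zero)"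
proof (induction n)
  case (Suc n)
  then show ?case by (cases n) (auto simp: normal_W)
qed simp

lemma normal_fs: "normal a \<Longrightarrow> normal (fs a x)"
proof (induction a x rule: fs.induct)
  case (2 a x)
  then show ?case by (auto simp: normal_pred normal_funpow simp del: funpow.simps)
next
  case (3 a c d x)
  have "u \<le> c" if "fs (W c d) x = W u v" for u v
  proof (cases d)
    case Zero
    then show ?thesis using that fs_less[of "c" x] pred_le[of c]
      by (cases "c = Zero") (auto split: if_splits)
  next
    case (W e f)
    then show ?thesis using that by simp
  qed
  then show ?case using 3 by (auto simp: normal_W simp del: fs.simps dest: order_trans) (auto simp: normal_W)
qed simp

text \<open>Exponents do not increase in normal form, so no summand of \<open>b\<close> exceeds
  \<omega> to the power \<open>p\<close>; one copy more than the number of summands is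
  enough.\<close>

lemma less_W_funpow:
  "normal b \<Longrightarrow> (\<And>u v. b = W u v \<Longrightarrow> u \<le> p) \<Longrightarrow> \<exists>n. b < (W p ^^ Suc n) Zero"
proof (induction b)
  case (W u v)
  have "u \<le> p" using W by simp
  then have "\<exists>n. v < (W p ^^ Suc n) Zero"
    using W.IH(2) W.prems(1) by (auto simp: normal_W simp del: funpow.simps intro: order_trans)
  then obtain n where "v < (W p ^^ Suc n) Zero" by blast
  moreover note \<open>u \<le> p\<close>
  ultimately have "W u v < (W p ^^ Suc (Suc n)) Zero" by (auto simp: order.order_iff_strict)
  then show ?case by blast
qed auto

lemma fs_cofinal: "b < a \<Longrightarrow> \<not> is_succ a \<Longrightarrow> normal b \<Longrightarrow> \<exists>x. b < fs a x"
proof (induction a arbitrary: b)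
  case (W a t)
  show ?case
  proof (cases b)
    case Zero
    have "fs (W a t) 0 \<noteq> Zero" using fs_nonzero W.prems by blast
    then have "Zero < fs (W a t) 0" by (cases "fs (W a t) 0") auto
    then show ?thesis using Zero by blast
  next
    case b: (W u v)
    show ?thesis
    proof (cases t)
      case Zero
      then have ua: "u < a" using W.prems b by auto
      show ?thesis
      proof (cases "is_succ a")
        case True
        have "u \<le> pred a" using less_pred[OF ua True] W.prems b by (auto simp: normal_W)
        then obtain n where "b < (W (pred a) ^^ Suc n) Zero"
          using less_W_funpow[of b "pred a"] W.prems b by (auto simp: normal_W order_trans)
        then show ?thesis using True Zero by auto
      next
        case False
        then obtain x where "u < fs a x" using W.IH(1)[OF ua] W.prems b by (auto simp: normal_W)
        then show ?thesis using b Zero False by auto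
      qed
    next
      case t: (W c d)
      show ?thesis
      proof (cases "u = a")
        case True
        then have "v < t" "normal v" using b W.prems by (auto simp: normal_W)
        then obtain x where "v < fs t x" using W.IH(2)[of v] W.prems t by auto
        then show ?thesis using t b True by auto
      next
        case False
        then show ?thesis using t b W.prems by auto
      qed
    qed
  qed
qed simp

text \<open>This turns eventual domination into domination with an explicit threshold: stepping down
  at argument y from an index \<ge> m stays above m as long as m \<le> y.\<close>

lemma fin_le_fs: "a \<noteq> Zero \<Longrightarrow> \<not> is_succ a \<Longrightarrow> fin (Suc x) \<le> fs a x"
proof (induction a x rule: fs.induct)
  case (2 a x)
  show ?case
  proof (cases "is_succ a")
    case True
    have "fin n \<le> (W b ^^ n) Zero" for n b
      by (induction n) (use Zero_le[of b] in \<open>auto simp: fin_def W_le order.order_iff_strict\<close>)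
    from this[of "Suc x"] show ?thesis using True by simp
  next
    case False
    then have "Zero < fs a x" using 2 fs_nonzero[of a x] by (metis Zero_le is_succ.simps(2) order.order_iff_strict)
    then show ?thesis using False by (simp add: fin_def W_le)
  qed
next
  case (3 a c d x)
  then have "fin (Suc x) \<le> fs (W c d) x" by auto
  moreover have "fin x \<le> fin (Suc x)" for x by (induction x) (auto simp: fin_def W_le)
  ultimately have "fin x \<le> fs (W c d) x" using order_trans by blast
  then show ?case using order.order_iff_strict[of Zero a] by (auto simp: fin_def W_le)
qed simp


section \<open>Finite indices and comparison of different indices\<close>

lemma fin_0 [simp]: "fin 0 = Zero" and fin_Suc: "fin (Suc n) = W Zero (fin n)"
  by (simp_all add: fin_def)

lemma is_succ_fin: "is_succ (fin (Suc n))" and pred_fin: "pred (fin (Suc n)) = fin n"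
  by (induction n) (simp_all add: fin_Suc)

lemma normal_fin: "normal (fin n)"
proof (induction n)
  case (Suc n)
  then show ?case by (cases n) (auto simp: fin_Suc normal_W)
qed simp

lemma fin_mono: "m \<le> n \<Longrightarrow> fin m \<le> fin n"
proof (induction m arbitrary: n)
  case (Suc m)
  then show ?case by (cases n) (auto simp: fin_Suc W_le)
qed simp

lemma fin_less: "m < n \<Longrightarrow> fin m < fin n"
proof (induction m arbitrary: n)
  case 0
  then show ?case by (cases n) (auto simp: fin_Suc)
next
  case (Suc m)
  then show ?case by (cases n) (auto simp: fin_Suc)
qed

lemma F_fin_Suc: "F (fin (Suc m)) x = (F (fin m) ^^ Suc x) x"
  using F_succ[OF is_succ_nonzero is_succ_fin] is_succ_fin by (simp add: pred_fin)

lemma F_fin_1: "F (fin 1) x = 2 * x + 1"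
proof -
  have "(F Zero ^^ n) x = x + n" for n by (induction n) (auto simp: F_Zero)
  from this[of "Suc x"] show ?thesis
    using F_fin_Suc[of 0 x] by (simp del: funpow.simps)
qed

text \<open>Adding 1 turns \<open>F (fin 1)\<close> into doubling, so the exact value is 2^(x+1)
  (x+1) - 1. Squaring is the growth used later to absorb polynomials.\<close>

lemma F_fin_2: "x * x \<le> F (fin 2) x"
proof -
  have 1: "Suc ((F (fin 1) ^^ n) x) = 2 ^ n * Suc x" for n
  proof (induction n)
    case (Suc n)
    then show ?case using F_fin_1[of "(F (fin 1) ^^ n) x"] by simp
  qed simp
  have "Suc x * Suc x \<le> 2 ^ Suc x * Suc x"
    by (rule mult_right_mono) (use less_exp[of "Suc x"] in auto)
  also have "\<dots> = Suc (F (fin 2) x)"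
    using 1[of "Suc x"] F_fin_Suc[of 1 x] by (simp add: numeral_2_eq_2 del: funpow.simps)
  finally show ?thesis by simp
qed

text \<open>One step from \<open>d\<close> leads to an \<open>e\<close> that is still \<ge>
  \<open>b\<close>: the predecessor, or by cofinality a member of the fundamental sequence. The
  index K of that member enters the threshold, because \<open>F_red\<close> compares values only at
  arguments \<ge> K.\<close>

lemma F_dominates:
  "normal d \<Longrightarrow> normal b \<Longrightarrow> b \<le> d \<Longrightarrow> \<exists>K. \<forall>x\<ge>K. F b x \<le> F d x"
proof (induction d rule: wf_induct_rule[OF wf_descent])
  case (1 d)
  show ?case
  proof (cases "b = d")
    case False
    then have bd: "b < d" using 1 by simp
    then have nz: "d \<noteq> Zero" by auto
    obtain e K where e: "(d, e) \<in> red K" "b \<le> e" "normal e"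
    proof (cases "is_succ d")
      case True
      then show ?thesis using that[of "pred d" 0] less_pred[OF bd] 1 nz normal_pred by (auto simp: red_def)
    next
      case False
      then obtain x where "b < fs d x" using fs_cofinal[OF bd] 1 by auto
      then show ?thesis using that[of "fs d x" x] 1 nz False normal_fs by (auto simp: red_def)
    qed
    obtain K' where "\<forall>x\<ge>K'. F b x \<le> F e x"
      using 1(1)[OF red_descent[OF e(1)]] e 1 by blast
    then have "\<forall>x\<ge>max K K'. F b x \<le> F d x"
      using F_red[OF _ e(1)] by (meson max.bounded_iff order_trans)
    then show ?thesis by blast
  qed blast
qed

lemma F_fin_dominates:
  "normal d \<Longrightarrow> fin m \<le> d \<Longrightarrow> m \<le> y \<Longrightarrow> F (fin m) y \<le> F d y"
proof (induction d rule: wf_induct_rule[OF wf_descent])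
  case (1 d)
  show ?case
  proof (cases "fin m = d")
    case False
    then have md: "fin m < d" using 1 by simp
    then have nz: "d \<noteq> Zero" by auto
    obtain e where e: "(d, e) \<in> red y" "fin m \<le> e" "normal e"
    proof (cases "is_succ d")
      case True
      then show ?thesis using that[of "pred d"] less_pred[OF md] 1 nz normal_pred normal_fin
        by (auto simp: red_def)
    next
      case False
      have "fin m \<le> fs d y"
        using fin_le_fs[OF nz False, of y] fin_mono[of m "Suc y"] 1 by (auto dest: order_trans)
      then show ?thesis using that[of "fs d y"] 1 nz False normal_fs by (auto simp: red_def)
    qed
    then have "F (fin m) y \<le> F e y" using 1 red_descent by blast
    also have "\<dots> \<le> F d y" using F_red[OF _ e(1)] by simp
    finally show ?thesis .
  qed simp
qed

text \<open>At a successor, \<open>F a (Suc y)\<close> has one iteration of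
  \<open>F (pred a)\<close> more than \<open>F a y\<close>, and this outermost one dominates
  \<open>F (fin 2)\<close> since \<open>pred a\<close> is at least 2. At a limit, the claim for
  \<open>fs a y\<close> is carried over by one step at y, compared at the argument y + 1; here y
  \<ge> 2 ensures that \<open>fs a y\<close> is still at least 3.\<close>

lemma F_Suc_ge:
  "normal a \<Longrightarrow> fin 3 \<le> a \<Longrightarrow> 2 \<le> y \<Longrightarrow> F (fin 2) (F a y) \<le> F a (Suc y)"
proof (induction a rule: wf_induct_rule[OF wf_descent])
  case (1 a)
  have 2: "fin 2 < a" using fin_less[of 2 3] 1 by simp
  then have nz: "a \<noteq> Zero" by auto
  show ?case
  proof (cases "is_succ a")
    case True
    note p = less_pred[OF 2 True normal_fin]
    have "2 \<le> F a y" using F_gt[of y a] 1 by linarith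
    then have "F (fin 2) (F a y) \<le> F (pred a) (F a y)"
      using F_fin_dominates[OF normal_pred p] 1 by blast
    also have "\<dots> \<le> F (pred a) ((F (pred a) ^^ Suc y) (Suc y))"
      using F_succ[OF nz True, of y] by (auto intro!: F_le funpow_mono F_mono simp del: funpow.simps)
    also have "\<dots> = F a (Suc y)" using F_succ[OF nz True, of "Suc y"] by simp
    finally show ?thesis .
  next
    case False
    have "fin 3 \<le> fs a y"
      using fin_le_fs[OF nz False, of y] fin_mono[of 3 "Suc y"] 1 by (auto dest: order_trans)
    then have "F (fin 2) (F (fs a y) y) \<le> F (fs a y) (Suc y)"
      using 1 nz False normal_fs by (auto simp: descent_def)
    also have "\<dots> \<le> F a (Suc y)"
      using F_red[of y "Suc y" a "fs a y"] nz False by (simp add: red_def)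
    finally show ?thesis using F_limit[OF nz False] by simp
  qed
qed

section \<open>Bounds on the extended Grzegorczyk classes\<close>

text \<open>Composition adds numbers of iterations, and limited recursion brings its own bound, so
  no recursion is ever unfolded. The shift \<open>K\<close> accommodates a domination that is only
  eventual: it is paid for by \<open>K\<close> further iterations of \<open>G\<close>, each adding
  at least 1. Inserting 0 keeps the maximum defined when k = 0.\<close>

lemma grz_bound:
  assumes mono: "mono G" and gt: "\<And>x. x < G x" and dbl: "\<And>x. 2 * x \<le> G x"
    and F: "\<And>x. F a x \<le> G (x + K)"
    and "grz a k f"
  shows "\<exists>c. \<forall>xs. length xs = k \<longrightarrow> f xs \<le> (G ^^ c) (Max (insert 0 (set xs)))"
  using \<open>grz a k f\<close>
proof induction
  case (grz_zero k)
  then show ?case by auto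
next
  case grz_add
  have "xs ! 0 + xs ! 1 \<le> (G ^^ 1) (Max (insert 0 (set xs)))" if "length xs = 2" for xs
  proof -
    have "xs ! i \<le> Max (insert 0 (set xs))" if "i < 2" for i
      using \<open>length xs = 2\<close> that by (intro Max_ge) auto
    from this[of 0] this[of 1] show ?thesis using dbl[of "Max (insert 0 (set xs))"] by auto
  qed
  then show ?case by blast
next
  case (grz_proj i k)
  then show ?case by (intro exI[of _ 0]) auto
next
  case grz_fast
  have "F a (xs ! 0) \<le> (G ^^ Suc K) (Max (insert 0 (set xs)))" if "length xs = 1" for xs
  proof -
    have "xs ! 0 \<le> Max (insert 0 (set xs))"
      using that by (intro Max_ge) auto
    then have "xs ! 0 + K \<le> (G ^^ K) (Max (insert 0 (set xs)))"
      using funpow_gt[OF gt] by (meson add_le_mono1 order_trans)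
    then show ?thesis using F[of "xs ! 0"] monoD[OF mono] by (auto intro: order_trans)
  qed
  then show ?case by blast
next
  case (grz_comp gs h k)
  obtain ch where ch: "length xs = length gs \<Longrightarrow> h xs \<le> (G ^^ ch) (Max (insert 0 (set xs)))" for xs
    using grz_comp by blast
  obtain cg where cg: "g \<in> set gs \<Longrightarrow> length xs = k \<Longrightarrow> g xs \<le> (G ^^ cg g) (Max (insert 0 (set xs)))" for g xs
    using grz_comp by metis
  define c where "c = Max (insert 0 (cg ` set gs))"
  have "h (map (\<lambda>g. g xs) gs) \<le> (G ^^ (ch + c)) (Max (insert 0 (set xs)))" if xs: "length xs = k" for xs
  proof -
    have "g xs \<le> (G ^^ c) (Max (insert 0 (set xs)))" if "g \<in> set gs" for g
    proof -
      have "cg g \<le> c" unfolding c_def using that by (intro Max_ge) auto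
      from funpow_mono_le[OF mono gt order_refl this] cg[OF that xs] show ?thesis by (rule order_trans[rotated])
    qed
    then have "Max (insert 0 (set (map (\<lambda>g. g xs) gs))) \<le> (G ^^ c) (Max (insert 0 (set xs)))"
      by (subst Max_le_iff) auto
    then have "(G ^^ ch) (Max (insert 0 (set (map (\<lambda>g. g xs) gs)))) \<le> (G ^^ ch) ((G ^^ c) (Max (insert 0 (set xs))))"
      by (rule funpow_mono[OF mono])
    then show ?thesis using ch[of "map (\<lambda>g. g xs) gs"] by (simp add: funpow_add)
  qed
  then show ?case by blast
next
  case (grz_limrec k g h b f)
  obtain c where c: "length xs = 1 \<Longrightarrow> b xs \<le> (G ^^ c) (Max (insert 0 (set xs)))" for xs
    using grz_limrec by blast
  have "f xs \<le> (G ^^ c) (Max (insert 0 (set xs)))" if len: "length xs = k + 1" for xs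
  proof -
    obtain n ys where xs: "xs = n # ys" "length ys = k" using len by (cases xs) auto
    then have "f xs \<le> b [Max (set xs)]" using grz_limrec by blast
    also have "\<dots> \<le> (G ^^ c) (Max (insert 0 (set xs)))" using c[of "[Max (set xs)]"] xs by simp
    finally show ?thesis .
  qed
  then show ?case by blast
next
  case (grz_ext k f f')
  then show ?case by auto
qed

lemma grz_F_bound:
  assumes "grz b 1 (\<lambda>xs. p (xs ! 0))" "normal b" "normal d" "b \<le> d" "fin 2 \<le> d"
  shows "\<exists>c. \<forall>n. p n \<le> (F d ^^ c) n"
proof -
  obtain K where K: "\<forall>x\<ge>K. F b x \<le> F d x" using F_dominates assms by blast
  have dbl: "2 * x \<le> F d x" for x
  proof (cases "x \<le> 1")
    case True
    then show ?thesis using F_gt[of x d] by linarith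
  next
    case False
    have "fin 1 \<le> d" using fin_mono[of 1 2] assms(5) by (metis numeral_One one_le_numeral order_trans)
    then have "F (fin 1) x \<le> F d x" by (rule F_fin_dominates[OF assms(3)]) (use False in simp)
    then show ?thesis using F_fin_1[of x] by linarith
  qed
  have "F b x \<le> F d (x + K)" for x
    using F_le[of x "x + K" b] K by (meson le_add1 le_add2 order_trans)
  from grz_bound[OF F_mono F_gt dbl this assms(1)] obtain c
    where "\<And>xs. length xs = 1 \<Longrightarrow> p (xs ! 0) \<le> (F d ^^ c) (Max (insert 0 (set xs)))" by blast
  from this[of "[n]" for n] show ?thesis by auto
qed

lemma grz_funpow: "grz d 1 (\<lambda>xs. (F d ^^ c) (xs ! 0))"
proof (induction c)
  case 0
  then show ?case by (simp add: grz_proj)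
next
  case (Suc c)
  have "grz d 1 (\<lambda>xs. F d (map (\<lambda>g. g xs) [\<lambda>xs. (F d ^^ c) (xs ! 0)] ! 0))"
    by (rule grz_comp) (use Suc grz_fast in auto)
  then show ?case by simp
qed

text \<open>\<open>X\<close> is a common bound for the steps of the oracle machine and for the time
  spent on any query of length j \<le> f n; a simulation quadratic in \<open>X\<close> must still
  fit the class.\<close>

lemma polynomial_overhead:
  assumes a: "normal a" "fin 3 \<le> a" and f: "f \<in> grz_below a" and p: "p \<in> grz_below a"
  obtains r X where "r \<in> grz_below a" "\<And>n. f n \<le> X n" "\<And>n j. j \<le> f n \<Longrightarrow> F a (p j) \<le> X n"
    "\<And>n. K * (X n + 1) * (X n + 1) \<le> F a (r n)"
proof -
  obtain b where b: "b < a" "normal b" "grz b 1 (\<lambda>xs. f (xs ! 0))" using f by (auto simp: grz_below_def)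
  obtain c where c: "c < a" "normal c" "grz c 1 (\<lambda>xs. p (xs ! 0))" using p by (auto simp: grz_below_def)
  define d where "d = max (max b c) (fin 2)"
  have d: "d < a" "normal d" "b \<le> d" "c \<le> d" "fin 2 \<le> d"
    using b c a fin_less[of 2 3] normal_fin by (auto simp: d_def max_def split: if_splits)
  obtain B where B: "\<And>n. f n \<le> (F d ^^ B) n" using grz_F_bound b d by metis
  obtain C where C: "\<And>n. p n \<le> (F d ^^ C) n" using grz_F_bound c d by metis
  \<comment> \<open>\<open>C + B\<close> iterations bound p at all arguments up to f n,
    \<open>4 * K\<close> makes \<open>X\<close> exceed the constant factor met below, and 2 supplies
    the argument \<ge> 2 that \<open>F_Suc_ge\<close> asks for.\<close>
  define D where "D = C + B + 4 * K + 2"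
  define X where "X n = F a ((F d ^^ D) n)" for n
  define r where "r n = (F d ^^ (2 + D)) n" for n
  have Dn: "n + D \<le> (F d ^^ D) n" for n by (rule funpow_gt[OF F_gt])
  have Xn: "n + D \<le> X n" for n using Dn[of n] F_gt[of "(F d ^^ D) n" a] by (simp add: X_def)
  show thesis
  proof
    show "r \<in> grz_below a" using d grz_funpow[of d "2 + D"] by (auto simp: grz_below_def r_def)
  next
    fix n
    have "f n \<le> (F d ^^ D) n"
      using B[of n] funpow_mono_le[OF F_mono F_gt order_refl, of B D d n] by (simp add: D_def)
    then show "f n \<le> X n" using F_gt[of "(F d ^^ D) n" a] by (simp add: X_def)
  next
    fix n j assume "j \<le> f n"
    then have "p j \<le> (F d ^^ C) ((F d ^^ B) n)"
      using B[of n] C[of j] by (meson F_mono funpow_mono order_trans)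
    also have "\<dots> \<le> (F d ^^ D) n"
      using funpow_mono_le[OF F_mono F_gt order_refl, of "C + B" D d n] by (simp add: D_def funpow_add)
    finally show "F a (p j) \<le> X n" by (simp add: X_def F_le)
  next
    fix n
    define y where "y = (F d ^^ D) n"
    have y: "2 \<le> y" using Dn[of n] by (simp add: y_def D_def)
    have X: "4 * K \<le> X n" "1 \<le> X n" using Xn[of n] by (auto simp: D_def)
    \<comment> \<open>The left side is at most X^4, that is, two squarings of X. Each squaring
      raises the argument of \<open>F a\<close> by 1, which explains the two extra iterations in
      \<open>r\<close>.\<close>
    have "K * (X n + 1) * (X n + 1) \<le> K * (2 * X n) * (2 * X n)"
      using X by (intro mult_le_mono) auto
    also have "\<dots> = (4 * K) * (X n * X n)" by (simp add: algebra_simps)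
    also have "\<dots> \<le> (X n * X n) * (X n * X n)"
      using X by (intro mult_right_mono) (auto intro: order_trans)
    also have "\<dots> \<le> F (fin 2) (F (fin 2) (X n))"
      by (meson F_fin_2 mult_le_mono order_trans)
    also have "\<dots> \<le> F (fin 2) (F a (Suc y))"
      using F_Suc_ge[OF a y] by (simp add: X_def y_def F_le)
    also have "\<dots> \<le> F a (Suc (Suc y))" using F_Suc_ge[OF a, of "Suc y"] y by simp
    also have "\<dots> \<le> F a (r n)"
      using funpow_gt[of "F d" y 2, OF F_gt] by (intro F_le) (simp add: r_def y_def funpow_add numeral_2_eq_2)
    finally show "K * (X n + 1) * (X n + 1) \<le> F a (r n)" .
  qed
qed

section \<open>Relabelling machines\<close>

text \<open>\<open>DTime\<close> admits only machines over natural numbers, whereas the simulating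
  machine is built over datatypes; it is transported along \<open>to_nat\<close>.\<close>

definition relabel :: "('a, 'q::countable, 's::countable) tm \<Rightarrow> ('a, nat, nat) tm" where
  "relabel M = \<lparr>states = to_nat ` states M, symbols = to_nat ` symbols M, ntapes = ntapes M,
     blank = to_nat (blank M), letter = to_nat \<circ> letter M, start = to_nat (start M),
     accept = to_nat (accept M), reject = to_nat (reject M),
     delta = \<lambda>q ss. map_prod to_nat (map (map_prod to_nat id)) (delta M (from_nat q) (map from_nat ss))\<rparr>"

lemma wf_delta:
  assumes "wf_tm M" "q \<in> states M" "set ss \<subseteq> symbols M" "length ss = ntapes M" "delta M q ss = (q', acts)"
  shows "q' \<in> states M" "length acts = ntapes M" "fst ` set acts \<subseteq> symbols M"
proof -
  have "\<forall>q ss. q \<in> states M \<and> set ss \<subseteq> symbols M \<and> length ss = ntapes M \<longrightarrow>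
        (case delta M q ss of (q', acts) \<Rightarrow>
           q' \<in> states M \<and> length acts = ntapes M \<and> fst ` set acts \<subseteq> symbols M)"
    using assms(1) unfolding wf_tm_def by (elim conjE)
  from this[rule_format, of q ss] assms(2-5)
  show "q' \<in> states M" "length acts = ntapes M" "fst ` set acts \<subseteq> symbols M"
    by simp_all
qed

lemma wf_relabel:
  assumes "wf_tm M" shows "wf_tm (relabel M)"
proof -
  have "case delta (relabel M) q ss of (q', acts) \<Rightarrow> q' \<in> states (relabel M) \<and>
      length acts = ntapes (relabel M) \<and> fst ` set acts \<subseteq> symbols (relabel M)"
    if q: "q \<in> states (relabel M)" and ss: "set ss \<subseteq> symbols (relabel M)" "length ss = ntapes (relabel M)" for q ss
  proof -
    obtain q' acts where d: "delta M (from_nat q) (map from_nat ss) = (q', acts)" by fastforce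
    have "from_nat q \<in> states M" "set (map from_nat ss) \<subseteq> symbols M" "length (map from_nat ss) = ntapes M"
      using q ss by (auto simp: relabel_def)
    note w = wf_delta[OF assms this d]
    then show ?thesis using d by (auto simp: relabel_def image_subset_iff)
  qed
  then show ?thesis
    using assms unfolding wf_tm_def by (auto simp: relabel_def inj_def image_iff)
qed

fun relabel_config :: "('q::countable, 's::countable) config \<Rightarrow> (nat, nat) config" where
  "relabel_config (q, ts) = (to_nat q, map (map_prod ((\<circ>) to_nat) id) ts)"

lemma act_relabel: "act (map_prod to_nat id a) (map_prod ((\<circ>) to_nat) id t) = map_prod ((\<circ>) to_nat) id (act a t)"
  by (cases a; cases t) (auto simp: fun_eq_iff)

lemma acts_relabel: "map2 act (map (map_prod to_nat id) as) (map (map_prod ((\<circ>) to_nat) id) ts)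
    = map (map_prod ((\<circ>) to_nat) id) (map2 act as ts)"
proof (induction as ts rule: list_induct2')
  case (4 a as t ts)
  then show ?case by (simp only: list.map zip_Cons_Cons prod.case act_relabel)
qed simp_all

lemma step_relabel: "step (relabel M) (relabel_config c) = relabel_config (step M c)"
proof (cases c)
  case (Pair q ts)
  obtain q' acts where d: "delta M q (map (\<lambda>(t, h). t h) ts) = (q', acts)" by fastforce
  have "map from_nat (map (\<lambda>(t, h). t h) (map (map_prod ((\<circ>) to_nat) id) ts)) = map (\<lambda>(t, h). t h) ts"
    by auto
  then have "delta (relabel M) (to_nat q) (map (\<lambda>(t, h). t h) (map (map_prod ((\<circ>) to_nat) id) ts))
      = (to_nat q', map (map_prod to_nat id) acts)"
    using d unfolding relabel_def tm.simps by (simp only: from_nat_to_nat map_prod_simp)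
  then show ?thesis
    using Pair d by (auto simp: acts_relabel simp del: map_map) (auto simp: relabel_def)
qed

lemma init_relabel: "init (relabel M) w = relabel_config (init M w)"
  by (auto simp: init_def relabel_def)

lemma steps_relabel: "(step (relabel M) ^^ n) (relabel_config c) = relabel_config ((step M ^^ n) c)"
  by (induction n) (auto simp: step_relabel)

lemma fst_relabel_config: "fst (relabel_config c) = to_nat (fst c)"
  by (cases c) auto

lemma DTimeI:
  fixes M :: "('a, 'q::countable, 's::countable) tm"
  assumes "wf_tm M"
    and "\<And>w. \<exists>m \<le> t (length w). fst ((step M ^^ m) (init M w)) = (if w \<in> L then accept M else reject M)"
  shows "L \<in> DTime t"
proof -
  have "\<exists>m \<le> t (length w). fst ((step (relabel M) ^^ m) (init (relabel M) w))
      = (if w \<in> L then accept (relabel M) else reject (relabel M))" for w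
  proof -
    obtain m where "m \<le> t (length w)"
      "fst ((step M ^^ m) (init M w)) = (if w \<in> L then accept M else reject M)"
      using assms(2) by blast
    then have "fst ((step (relabel M) ^^ m) (init (relabel M) w))
        = to_nat (if w \<in> L then accept M else reject M)"
      by (simp only: init_relabel steps_relabel fst_relabel_config)
    with \<open>m \<le> t (length w)\<close> show ?thesis by (auto simp: relabel_def)
  qed
  then show ?thesis using wf_relabel[OF assms(1)] unfolding DTime_def by blast
qed

section \<open>Well-formed configurations and the extent of the query tape\<close>

definition valid :: "('a, 'q, 's, 'z) tm_scheme \<Rightarrow> ('q, 's) config \<Rightarrow> bool" where
  "valid M c \<longleftrightarrow> fst c \<in> states M \<and> length (snd c) = ntapes M \<and>
     (\<forall>t \<in> set (snd c). range (fst t) \<subseteq> symbols M)"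

fun read :: "'s tape \<Rightarrow> 's" where
  "read (t, h) = t h"

lemma read_eq: "(\<lambda>(t, h). t h) = read"
  by (auto simp: fun_eq_iff)

lemma valid_read: "valid M (q, ts) \<Longrightarrow> set (map read ts) \<subseteq> symbols M"
  by (fastforce simp: valid_def)

lemma valid_init: "wf_tm M \<Longrightarrow> valid M (init M w)"
  by (fastforce simp: valid_def init_def wf_tm_def)

lemma range_act: "range (fst t) \<subseteq> A \<Longrightarrow> fst a \<in> A \<Longrightarrow> range (fst (act a t)) \<subseteq> A"
  by (cases a; cases t) auto

lemma valid_step:
  assumes "wf_tm M" "valid M c" shows "valid M (step M c)"
proof (cases c)
  case (Pair q ts)
  have v: "q \<in> states M" "length ts = ntapes M" "\<forall>t\<in>set ts. range (fst t) \<subseteq> symbols M"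
    using assms Pair by (auto simp: valid_def)
  obtain q' acts where d: "delta M q (map read ts) = (q', acts)" by fastforce
  note w = wf_delta[OF assms(1) v(1) valid_read[OF assms(2)[unfolded Pair]] _ d]
  have "range (fst x) \<subseteq> symbols M" if x: "x \<in> set (map2 act acts ts)" for x
  proof -
    obtain y where "y \<in> set (zip acts ts)" "x = (\<lambda>(a, t). act a t) y"
      using x unfolding set_map by blast
    moreover obtain a t where "y = (a, t)" by (cases y)
    ultimately have "a \<in> set acts" "t \<in> set ts" "x = act a t"
      by (auto dest: set_zip_leftD set_zip_rightD simp del: act.simps)
    then show ?thesis using v w range_act[of t "symbols M" a] \<open>x = act a t\<close> by auto
  qed
  then show ?thesis using v w d assms(2) Pair by (auto simp: valid_def read_eq)
qed

lemma valid_ostep: "wf_otm M \<Longrightarrow> valid M c \<Longrightarrow> valid M (ostep B M c)"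
  using valid_step[of M c] by (cases c) (auto simp: wf_otm_def valid_def)

text \<open>Cells are bounded strictly and the head weakly: n steps after a blank start the head may
  be at distance n, but the last write preceded the last move. In particular cell n is
  blank.\<close>

fun near :: "'s \<Rightarrow> nat \<Rightarrow> 's tape \<Rightarrow> bool" where
  "near bl n (t, h) \<longleftrightarrow> (\<forall>i. t i \<noteq> bl \<longrightarrow> \<bar>i\<bar> < int n) \<and> \<bar>h\<bar> \<le> int n"

lemma near_mono: "near bl n t \<Longrightarrow> n \<le> m \<Longrightarrow> near bl m t"
  by (cases t) force

lemma near_act: "near bl n t \<Longrightarrow> near bl (Suc n) (act a t)"
proof (cases a; cases t)
  fix s d f h assume "near bl n t" "a = (s, d)" "t = (f, h)"
  then show ?thesis by (cases d) force+
qed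

lemma near_ostep:
  assumes "wf_otm M" "valid M c" "near (blank M) n (snd c ! 1)"
  shows "near (blank M) (Suc n) (snd (ostep B M c) ! 1)"
proof (cases c)
  case (Pair q ts)
  have w: "wf_tm M" "2 \<le> ntapes M" using assms by (auto simp: wf_otm_def)
  have v: "q \<in> states M" "length ts = ntapes M" using assms Pair by (auto simp: valid_def)
  obtain q' acts where d: "delta M q (map read ts) = (q', acts)" by fastforce
  have "length acts = ntapes M"
    using wf_delta[OF w(1) v(1) valid_read[OF assms(2)[unfolded Pair]] _ d] v by simp
  moreover have "near (blank M) n (ts ! 1)" using assms(3) Pair by simp
  note near_mono[OF this le_SucI[OF order_refl]] near_act[OF this, of "acts ! 1"]
  ultimately show ?thesis
    using d v w Pair by (auto simp: read_eq)
qed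

text \<open>Makes the existential over \<open>B\<close> in \<open>ostep\<close> a membership test
  for one word.\<close>

lemma queried_unique:
  assumes "inj (oletter M)" "queried M t w" "queried M t w'"
  shows "w = w'"
proof (rule nth_equalityI)
  show "length w = length w'"
    using assms by (metis linorder_cases queried_def rangeI)
  then show "w ! i = w' ! i" if "i < length w" for i
    using assms that unfolding queried_def by (metis injD)
qed

text \<open>The word ends before the first cell that holds no oracle letter; the blank cell
  \<open>n\<close> is a candidate, which bounds the length.\<close>

lemma queried_exists:
  assumes "blank M \<notin> range (oletter M)" "near (blank M) n (t, h)"
  obtains w where "queried M t w" "length w \<le> n"
proof -
  define l where "l = (LEAST i. t (int i) \<notin> range (oletter M))"
  have n: "t (int n) \<notin> range (oletter M)"
  proof -
    have "t (int n) = blank M" using assms(2) by force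
    then show ?thesis using assms(1) by simp
  qed
  have l: "t (int l) \<notin> range (oletter M)" "l \<le> n"
    unfolding l_def using n by (rule LeastI, rule Least_le)
  have "t (int i) \<in> range (oletter M)" if "i < l" for i
    using not_less_Least that unfolding l_def by blast
  then have "queried M t (map (\<lambda>i. inv (oletter M) (t (int i))) [0..<l])"
    using l by (auto simp: queried_def f_inv_into_f)
  then show thesis using that l by force
qed

section \<open>Answering oracle queries by a machine\<close>

text \<open>The simulating machine has the tapes \<open>t\<^sub>0 # t\<^sub>1 # z # ms @ ns\<close>: the tapes \<open>t\<^sub>0 # t\<^sub>1 # ms\<close> of \<open>M\<close>, with \<open>t\<^sub>1\<close>
  the query tape, the tapes \<open>ns\<close> of \<open>N\<close>, and a tape \<open>z\<close> whose head moves along with that of \<open>t\<^sub>1\<close>.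
  A symbol \<open>Zs p m\<close> on \<open>z\<close> says whether the cell is the origin and whether it is the position to
  which the head of \<open>t\<^sub>1\<close> has to return after the query. The first component of \<open>z\<close> together with the
  Boolean kept in the states, which tells whether the head is to the left of the origin (its value is
  irrelevant at the origin itself), allows the machine to find the origin.

  A query is answered by seeking the origin of \<open>t\<^sub>1\<close> (\<open>Seek\<close>), copying the queried word to the first
  tape of \<open>N\<close> (\<open>Copy\<close>), rewinding both (\<open>Rew\<close>), restoring the head of \<open>t\<^sub>1\<close> (\<open>Back\<close>), running \<open>N\<close> (\<open>Run\<close>) and
  erasing its tapes by a sweep to the right and one to the left (\<open>Cl1\<close>, \<open>Cl2\<close>). The heads on \<open>ns\<close>
  need not return to their starting positions, because these tapes are blank again.\<close>

datatype sym = Zs bool bool | SM nat | SN nat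

datatype st = Ini | Sim nat bool | Seek bool | Copy bool | Rew bool | Back bool
  | Run nat bool | Cl1 bool bool | Cl2 bool bool | Acc | Rej

instance sym :: countable by countable_datatype
instance st :: countable by countable_datatype

abbreviation Bl :: sym where "Bl \<equiv> Zs False False"

fun origin :: "sym \<Rightarrow> bool" where
  "origin (Zs p m) = p" | "origin _ = False"

fun marked :: "sym \<Rightarrow> bool" where
  "marked (Zs p m) = m" | "marked _ = False"

text \<open>Foreign symbols decode to the default, later the blank of the simulated machine. A cell
  with \<open>Bl\<close> thus reads as blank without initialisation, and yet differs from a cell
  where that blank has been written explicitly.\<close>

fun decM :: "nat \<Rightarrow> sym \<Rightarrow> nat" where
  "decM b (SM s) = s" | "decM b _ = b"

fun decN :: "nat \<Rightarrow> sym \<Rightarrow> nat" where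
  "decN b (SN s) = s" | "decN b _ = b"

definition keep :: "'s list \<Rightarrow> ('s \<times> move) list" where
  "keep = map (\<lambda>s. (s, Stay))"

lemma act_keep: "map2 act (keep (map read ts)) ts = ts"
  by (induction ts) (auto simp: keep_def)

lemma length_keep [simp]: "length (keep ss) = length ss"
  by (simp add: keep_def)

lemma keep_Cons: "keep (s # ss) = (s, Stay) # keep ss"
  by (simp add: keep_def)

lemma act_Stay_read: "act (read t, Stay) t = t"
  by (cases t) auto

lemma acts_map: "map2 act (map f (map read ts)) ts = map (\<lambda>t. act (f (read t)) t) ts"
  by (induction ts) auto

lemma keep_append: "keep (xs @ ys) = keep xs @ keep ys"
  by (simp add: keep_def)

definition dirty :: "(int \<Rightarrow> sym) \<Rightarrow> int set" where
  "dirty t = {i. t i \<noteq> Bl}"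

lemma Bl_iff: "t i = Bl \<longleftrightarrow> i \<notin> dirty t"
  by (simp add: dirty_def)

text \<open>Every symbol written while simulating \<open>N\<close>, its own blank included, differs from \<open>Bl\<close>, so the
  cells to be erased after a query form an interval that contains or touches the head.\<close>

fun swept :: "nat \<Rightarrow> sym tape \<Rightarrow> bool" where
  "swept n (t, h) \<longleftrightarrow> (\<exists>lo hi. dirty t = {lo..<hi} \<and> lo \<le> hi \<and>
     lo - 1 \<le> h \<and> h \<le> hi \<and> hi - lo \<le> int n)"

lemma swept_mono: "swept n t \<Longrightarrow> n \<le> m \<Longrightarrow> swept m t"
proof (cases t)
  case (Pair f h)
  assume "swept n t" "n \<le> m"
  from this(1) obtain lo hi where
    "dirty f = {lo..<hi}" "lo \<le> hi" "lo - 1 \<le> h" "h \<le> hi" "hi - lo \<le> int n"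
    unfolding Pair swept.simps by blast
  moreover from this(5) \<open>n \<le> m\<close> have "hi - lo \<le> int m" by linarith
  ultimately show "swept m t" unfolding Pair swept.simps by blast
qed

lemma swept_act:
  assumes "swept n t" "fst a \<noteq> Bl"
  shows "swept (Suc n) (act a t)"
proof -
  obtain s d f h where a: "a = (s, d)" "t = (f, h)" by (cases a; cases t)
  obtain lo hi where v: "dirty f = {lo..<hi}" "lo \<le> hi" "lo - 1 \<le> h" "h \<le> hi" "hi - lo \<le> int n"
    using assms a by auto
  have "dirty (f(h := s)) = insert h (dirty f)"
    using assms(2) a by (auto simp: dirty_def)
  also have "\<dots> = {min lo h..<max hi (h + 1)}"
    using v by auto
  finally have "dirty (f(h := s)) = {min lo h..<max hi (h + 1)}" .
  moreover have "min lo h \<le> max hi (h + 1)" "min lo h - 1 \<le> h + shift d" "h + shift d \<le> max hi (h + 1)"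
    "max hi (h + 1) - min lo h \<le> int (Suc n)"
    using v by (cases d; auto)+
  ultimately show ?thesis unfolding a act.simps swept.simps by blast
qed

text \<open>The offset \<open>h - g\<close> is arbitrary but constant during a run: N starts on its
  cell 0, while the simulating heads stand wherever the previous query left them.\<close>

fun embeds :: "nat \<Rightarrow> nat \<Rightarrow> nat tape \<Rightarrow> sym tape \<Rightarrow> bool" where
  "embeds bl n (u, g) (t, h) \<longleftrightarrow> (\<forall>i. u i = decN bl (t (i + (h - g)))) \<and> swept n (t, h)"

lemma embeds_read: "embeds bl n u t \<Longrightarrow> read u = decN bl (read t)"
  by (cases u; cases t) auto

lemma embeds_mono: "embeds bl n u t \<Longrightarrow> n \<le> m \<Longrightarrow> embeds bl m u t"
  using swept_mono by (cases u; cases t) (auto simp del: swept.simps)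

lemma embeds_act:
  assumes "embeds bl n u t" shows "embeds bl (Suc n) (act a u) (act (map_prod SN id a) t)"
proof -
  obtain s d f h v g where a: "a = (s, d)" "t = (f, h)" "u = (v, g)" by (cases a; cases t; cases u)
  have "swept (Suc n) (act (map_prod SN id a) t)"
    using assms a by (intro swept_act) auto
  then show ?thesis using assms a by (auto simp del: swept.simps)
qed

text \<open>After a run the head may stand on a \<open>Bl\<close> cell just left of the visited
  interval, where a sweep to the right would stop at once. Rewriting the scanned symbol as an
  \<open>SN\<close> symbol adds that cell to the interval.\<close>

lemma swept_mark:
  assumes "swept n t" "act (SN s, Stay) t = (t', h')"
  shows "\<exists>lo hi. dirty t' = {lo..<hi} \<and> lo < hi \<and> lo \<le> h' \<and> h' \<le> hi \<and>
      hi - h' \<le> int (Suc n) \<and> hi - lo \<le> int (Suc n)"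
proof (cases t)
  case (Pair f h)
  then obtain lo hi where v: "dirty f = {lo..<hi}" "lo \<le> hi" "lo - 1 \<le> h" "h \<le> hi" "hi - lo \<le> int n"
    using assms(1) by auto
  have t': "t' = f(h := SN s)" "h' = h" using assms(2) Pair by auto
  have "dirty t' = insert h (dirty f)" unfolding t' by (auto simp: dirty_def)
  also have "\<dots> = {min lo h..<max hi (h + 1)}" using v by auto
  finally have "dirty t' = {min lo h..<max hi (h + 1)}" .
  moreover have "min lo h < max hi (h + 1)" "min lo h \<le> h'" "h' \<le> max hi (h + 1)"
    "max hi (h + 1) - h' \<le> int (Suc n)" "max hi (h + 1) - min lo h \<le> int (Suc n)"
    using v unfolding t' by auto
  ultimately show ?thesis by blast
qed

fun decT :: "nat \<Rightarrow> sym tape \<Rightarrow> nat tape" where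
  "decT bl (t, h) = (\<lambda>i. decM bl (t i), h)"

lemma decT_read: "read (decT bl t) = decM bl (read t)"
  by (cases t) simp

lemma decT_act: "decT bl (act (map_prod SM id a) t) = act a (decT bl t)"
  by (cases a; cases t) auto

lemma decT_acts: "map (decT bl) (map2 act (map (map_prod SM id) as) ts) = map2 act as (map (decT bl) ts)"
proof (induction as ts rule: list_induct2')
  case (4 a as t ts)
  then show ?case by (simp only: list.map zip_Cons_Cons prod.case decT_act)
qed simp_all

section \<open>The simulating machine\<close>

locale reduction =
  fixes M :: "('a::finite, 'b::finite, nat, nat) otm" and N :: "('b, nat, nat) tm"
  assumes wfM: "wf_otm M" and wfN: "wf_tm N"
begin

abbreviation "dM \<equiv> decM (blank M)"
abbreviation "dN \<equiv> decN (blank N)"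

text \<open>In \<open>Sim\<close> the side bit is updated only at the origin, the one place from
  which a move can change sides. During the sweeps, heads reading \<open>Bl\<close> wait for the
  others, since the regions on the tapes of N differ; a sweep ends when all of them read
  \<open>Bl\<close>.\<close>

fun tr :: "st \<Rightarrow> sym \<Rightarrow> sym \<Rightarrow> sym \<Rightarrow> sym list \<Rightarrow> sym list \<Rightarrow> st \<times> (sym \<times> move) list" where
  "tr Ini s0 s1 z ms ns = (Sim (start M) False, keep (s0 # s1 # Zs True False # ms @ ns))"
| "tr (Sim q b) s0 s1 z ms ns =
    (if q = accept M then (Acc, keep (s0 # s1 # z # ms @ ns))
     else if q = reject M then (Rej, keep (s0 # s1 # z # ms @ ns))
     else if q = query M then (Seek b, keep (s0 # s1 # Zs (origin z) True # ms @ ns))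
     else case delta M q (map dM (s0 # s1 # ms)) of (q', acts) \<Rightarrow>
       (Sim q' (if origin z then snd (acts ! 1) = Left else b),
        map_prod SM id (acts ! 0) # map_prod SM id (acts ! 1) # (z, snd (acts ! 1))
          # map (map_prod SM id) (drop 2 acts) @ keep ns))"
| "tr (Seek b) s0 s1 z ms ns =
    (if origin z then (Copy b, keep (s0 # s1 # z # ms @ ns))
     else let d = (if b then Right else Left) in
       (Seek b, (s0, Stay) # (s1, d) # (z, d) # keep (ms @ ns)))"
| "tr (Copy b) s0 s1 z ms ns =
    (if dM s1 \<in> range (oletter M)
     then (Copy b, (s0, Stay) # (s1, Right) # (z, Right) # keep ms
       @ (SN (letter N (inv (oletter M) (dM s1))), Right) # keep (tl ns))
     else (Rew b, keep (s0 # s1 # z # ms @ ns)))"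
| "tr (Rew b) s0 s1 z ms ns =
    (if origin z then (Back b, keep (s0 # s1 # z # ms @ ns))
     else (Rew b, (s0, Stay) # (s1, Left) # (z, Left) # keep ms @ (hd ns, Left) # keep (tl ns)))"
| "tr (Back b) s0 s1 z ms ns =
    (if marked z then (Run (start N) b, keep (s0 # s1 # Zs (origin z) False # ms @ ns))
     else let d = (if b then Left else Right) in
       (Back b, (s0, Stay) # (s1, d) # (z, d) # keep (ms @ ns)))"
| "tr (Run p b) s0 s1 z ms ns =
    (if p = accept N \<or> p = reject N
     then (Cl1 (p = accept N) b, keep (s0 # s1 # z # ms @ map (\<lambda>s. SN (dN s)) ns))
     else case delta N p (map dN ns) of (p', acts) \<Rightarrow>
       (Run p' b, keep (s0 # s1 # z # ms) @ map (map_prod SN id) acts))"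
| "tr (Cl1 a b) s0 s1 z ms ns =
    (if set ns \<subseteq> {Bl} then (Cl2 a b, keep (s0 # s1 # z # ms) @ map (\<lambda>s. (s, Left)) ns)
     else (Cl1 a b, keep (s0 # s1 # z # ms) @ map (\<lambda>s. (s, if s = Bl then Stay else Right)) ns))"
| "tr (Cl2 a b) s0 s1 z ms ns =
    (if set ns \<subseteq> {Bl} then (Sim (if a then yes M else no M) b, keep (s0 # s1 # z # ms @ ns))
     else (Cl2 a b, keep (s0 # s1 # z # ms) @ map (\<lambda>s. (Bl, if s = Bl then Stay else Left)) ns))"
| "tr Acc s0 s1 z ms ns = (Acc, keep (s0 # s1 # z # ms @ ns))"
| "tr Rej s0 s1 z ms ns = (Rej, keep (s0 # s1 # z # ms @ ns))"

definition S :: "('a, st, sym) tm" where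
  "S = \<lparr>states = {Ini, Acc, Rej} \<union> (\<lambda>(q, b). Sim q b) ` (states M \<times> UNIV) \<union> range Seek \<union> range Copy
       \<union> range Rew \<union> range Back \<union> (\<lambda>(q, b). Run q b) ` (states N \<times> UNIV)
       \<union> range (\<lambda>(a, b). Cl1 a b) \<union> range (\<lambda>(a, b). Cl2 a b),
     symbols = range (\<lambda>(p, m). Zs p m) \<union> SM ` symbols M \<union> SN ` symbols N,
     ntapes = ntapes M + 1 + ntapes N, blank = Bl, letter = SM \<circ> letter M,
     start = Ini, accept = Acc, reject = Rej,
     delta = \<lambda>q ss. tr q (ss ! 0) (ss ! 1) (ss ! 2)
       (take (ntapes M - 2) (drop 3 ss)) (drop (ntapes M - 2) (drop 3 ss))\<rparr>"

lemma wfM_tm: "wf_tm M" and ntapesM: "2 \<le> ntapes M" and ntapesN: "1 \<le> ntapes N"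
  and inj_oletter: "inj (oletter M)"
  using wfM wfN by (auto simp: wf_otm_def wf_tm_def)

lemmas deltaM = wf_delta[OF wfM_tm] and deltaN = wf_delta[OF wfN]

lemma dM_symbols: "s \<in> symbols S \<Longrightarrow> dM s \<in> symbols M"
  and dN_symbols: "s \<in> symbols S \<Longrightarrow> dN s \<in> symbols N"
  and Zs_symbols: "Zs p m \<in> symbols S"
  and SM_symbols: "SM j \<in> symbols S \<longleftrightarrow> j \<in> symbols M"
  and SN_symbols: "SN j \<in> symbols S \<longleftrightarrow> j \<in> symbols N"
  using wfM_tm wfN by (auto simp: S_def wf_tm_def)

lemma keep_symbols: "fst ` set (keep ss) = set ss" "(s, d) \<in> set (keep ss) \<longleftrightarrow> s \<in> set ss \<and> d = Stay"
  by (auto simp: keep_def image_iff)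

lemma states_S:
  "Ini \<in> states S" "Acc \<in> states S" "Rej \<in> states S" "Seek b \<in> states S" "Copy b \<in> states S"
  "Rew b \<in> states S" "Back b \<in> states S" "Cl1 a b \<in> states S" "Cl2 a b \<in> states S"
  "Sim q b \<in> states S \<longleftrightarrow> q \<in> states M" "Run p b \<in> states S \<longleftrightarrow> p \<in> states N"
  by (auto simp: S_def)

lemma fst_map_prod_image: "fst ` map_prod f g ` A = f ` fst ` A"
  by force

lemma image_symbols:
  "SM ` A \<subseteq> symbols S \<longleftrightarrow> A \<subseteq> symbols M" "SN ` B \<subseteq> symbols S \<longleftrightarrow> B \<subseteq> symbols N"
  by (auto simp: SM_symbols SN_symbols)

lemma tr_wf:
  assumes q: "q \<in> states S" and s: "s0 \<in> symbols S" "s1 \<in> symbols S" "z \<in> symbols S"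
      "set ms \<subseteq> symbols S" "set ns \<subseteq> symbols S"
    and l: "length ms = ntapes M - 2" "length ns = ntapes N"
    and tr: "tr q s0 s1 z ms ns = (q', acts)"
  shows "q' \<in> states S \<and> length acts = ntapes S \<and> fst ` set acts \<subseteq> symbols S"
proof -
  note simps = keep_symbols image_symbols fst_map_prod_image SM_symbols SN_symbols Zs_symbols image_Un image_image
    states_S Let_def
  have nS: "ntapes S = 3 + (ntapes M - 2) + ntapes N" using ntapesM by (simp add: S_def)
  show ?thesis
  proof (cases q)
    case (Sim p b)
    have p: "p \<in> states M" using q Sim by (simp add: states_S)
    obtain p' as where d: "delta M p (map dM (s0 # s1 # ms)) = (p', as)" by fastforce
    have sub: "set (map dM (s0 # s1 # ms)) \<subseteq> symbols M" using s dM_symbols by auto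
    have "length (map dM (s0 # s1 # ms)) = ntapes M" using l ntapesM by simp
    note w = deltaM[OF p sub this d]
    have as: "fst x \<in> symbols M" if "x \<in> set as" for x
      using w(3) that by auto
    have a: "fst (as ! 0) \<in> symbols M" "fst (as ! 1) \<in> symbols M"
      using w(2) l ntapesM by (auto intro!: as nth_mem)
    have b: "fst ` set (drop 2 as) \<subseteq> symbols M"
      by (auto intro: as dest: in_set_dropD)
    show ?thesis
    proof (cases "p = accept M \<or> p = reject M \<or> p = query M")
      case True
      then show ?thesis using tr Sim s l nS by (auto simp: simps split: if_splits)
    next
      case False
      then have "acts = map_prod SM id (as ! 0) # map_prod SM id (as ! 1) # (z, snd (as ! 1))
          # map (map_prod SM id) (drop 2 as) @ keep ns" "\<exists>b. q' = Sim p' b"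
        using tr Sim d by auto
      then show ?thesis using s l nS w(1,2) a b 
        by (auto simp only: simps set_append set_simps set_map image_insert fst_conv length_append length_map
            length_drop length_keep list.size insert_subset Un_subset_iff fst_map_prod)
    qed
  next
    case (Run p b)
    have p: "p \<in> states N" using q Run by (simp add: states_S)
    obtain p' as where d: "delta N p (map dN ns) = (p', as)" by fastforce
    have sub: "set (map dN ns) \<subseteq> symbols N" using s dN_symbols by auto
    have "length (map dN ns) = ntapes N" using l by simp
    note w = deltaN[OF p sub this d]
    have as: "x \<in> symbols N" if "(x, y) \<in> set as" for x y
      using w(3) that by force
    show ?thesis
      using tr Run d s[unfolded subset_iff] l nS w(1,2) by (auto simp: simps dN_symbols as split: if_splits)
  next
    case (Copy b)
    obtain n0 nr where "ns = n0 # nr" using l ntapesN by (cases ns) auto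
    moreover have "letter N x \<in> symbols N" for x using wfN by (auto simp: wf_tm_def)
    ultimately show ?thesis using tr Copy s l nS by (auto simp: simps split: if_splits)
  next
    case (Rew b)
    obtain n0 nr where "ns = n0 # nr" using l ntapesN by (cases ns) auto
    then show ?thesis using tr Rew s l nS by (auto simp: simps split: if_splits)
  next
    case (Cl2 a b)
    have "yes M \<in> states M" "no M \<in> states M" using wfM by (auto simp: wf_otm_def)
    then show ?thesis using tr Cl2 s l nS by (auto simp: simps split: if_splits)
  next
    case Ini
    have "start M \<in> states M" using wfM_tm by (auto simp: wf_tm_def)
    then show ?thesis using tr Ini s l nS by (auto simp: simps)
  next
    case (Back b)
    have "start N \<in> states N" using wfN by (auto simp: wf_tm_def)
    then show ?thesis using tr Back s l nS by (auto simp: simps split: if_splits)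
  next
    case (Cl1 a b)
    then show ?thesis using tr s l nS by (auto simp: simps split: if_splits)
  qed (use tr s l nS in \<open>auto simp: simps split: if_splits\<close>)
qed

lemma wf_S: "wf_tm S"
proof -
  have "finite (states S)" "finite (symbols S)"
    using wfM_tm wfN by (auto simp: S_def wf_tm_def)
  moreover have "inj (letter S)" "range (letter S) \<subseteq> symbols S - {blank S}"
    using wfM_tm by (auto simp: S_def wf_tm_def inj_def)
  moreover have "case delta S q ss of (q', acts) \<Rightarrow> q' \<in> states S \<and>
      length acts = ntapes S \<and> fst ` set acts \<subseteq> symbols S"
    if q: "q \<in> states S" and ss: "set ss \<subseteq> symbols S" "length ss = ntapes S" for q ss
  proof -
    have l: "length ss = ntapes M + 1 + ntapes N" using ss by (simp add: S_def)
    then have "{ss ! 0, ss ! 1, ss ! 2} \<subseteq> set ss" using ntapesM by auto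
    then have "ss ! 0 \<in> symbols S" "ss ! 1 \<in> symbols S" "ss ! 2 \<in> symbols S" using ss by auto
    moreover have "set (take (ntapes M - 2) (drop 3 ss)) \<subseteq> symbols S" "set (drop (ntapes M - 2) (drop 3 ss)) \<subseteq> symbols S"
      using ss by (auto dest!: in_set_takeD in_set_dropD)
    ultimately have "q' \<in> states S \<and> length acts = ntapes S \<and> fst ` set acts \<subseteq> symbols S"
      if "delta S q ss = (q', acts)" for q' acts
      using tr_wf[OF q] that l ntapesM by (simp add: S_def)
    then show ?thesis by (auto split: prod.splits)
  qed
  ultimately show ?thesis unfolding wf_tm_def by (auto simp: S_def)
qed

lemma step_S:
  assumes "length ms = ntapes M - 2" "length ns = ntapes N" "q \<noteq> Acc" "q \<noteq> Rej"
  shows "step S (q, t0 # t1 # z # ms @ ns) =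
    (case tr q (read t0) (read t1) (read z) (map read ms) (map read ns) of
       (q', acts) \<Rightarrow> (q', map2 act acts (t0 # t1 # z # ms @ ns)))"
proof -
  show ?thesis using assms by (simp add: S_def numeral_3_eq_3 read_eq)
qed

declare step.simps [simp del]

section \<open>The phases of answering a query\<close>

lemmas keep_simps = keep_append keep_Cons act_keep act_Stay_read zip_append

lemma seek:
  assumes "length ms = ntapes M - 2" "length ns = ntapes N" "\<forall>i. origin (zc i) \<longleftrightarrow> i = 0"
    "g = (if b then - int n else int n)"
  shows "(step S ^^ Suc n) (Seek b, t0 # (t1, g) # (zc, g) # ms @ ns) =
    (Copy b, t0 # (t1, 0) # (zc, 0) # ms @ ns)"
  using assms(4)
proof (induction n arbitrary: g)
  case 0
  then show ?case using assms(1-3) by (simp add: step_S keep_simps)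
next
  case (Suc n)
  define g' where "g' = (if b then - int n else int n)"
  have "step S (Seek b, t0 # (t1, g) # (zc, g) # ms @ ns) = (Seek b, t0 # (t1, g') # (zc, g') # ms @ ns)"
    using assms(1-3) Suc.prems by (auto simp: step_S keep_simps Let_def g'_def)
  with Suc.IH[OF g'_def] show ?case unfolding funpow_Suc_right[of "Suc n"] by simp
qed

lemma go_back:
  assumes "length ms = ntapes M - 2" "length ns = ntapes N" "\<forall>i. marked (zc i) \<longleftrightarrow> i = h"
    "h - g = (if b then - int n else int n)"
  shows "(step S ^^ Suc n) (Back b, t0 # (t1, g) # (zc, g) # ms @ ns) =
    (Run (start N) b, t0 # (t1, h) # (zc(h := Zs (origin (zc h)) False), h) # ms @ ns)"
  using assms(4)
proof (induction n arbitrary: g)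
  case 0
  then have "g = h" by (cases b) simp_all
  moreover have "marked (zc h)" using assms(3) by simp
  ultimately show ?case using assms(1,2) by (simp add: step_S keep_simps fun_eq_iff)
next
  case (Suc n)
  define g' where "g' = h - (if b then - int n else int n)"
  have "\<not> marked (zc g)" using assms(3) Suc.prems by (cases b) auto
  moreover have "g + shift (if b then Left else Right) = g'" using Suc.prems by (auto simp: g'_def)
  ultimately have "step S (Back b, t0 # (t1, g) # (zc, g) # ms @ ns) = (Back b, t0 # (t1, g') # (zc, g') # ms @ ns)"
    using assms(1,2) by (simp add: step_S keep_simps Let_def)
  with Suc.IH[of g'] show ?case unfolding funpow_Suc_right[of "Suc n"] by (simp add: g'_def)
qed

lemma rewind:
  assumes "length ms = ntapes M - 2" "Suc (length nr) = ntapes N" "\<forall>i. origin (zc i) \<longleftrightarrow> i = 0"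
  shows "(step S ^^ Suc n) (Rew b, t0 # (t1, int n) # (zc, int n) # ms @ (tn, j + int n) # nr) =
    (Back b, t0 # (t1, 0) # (zc, 0) # ms @ (tn, j) # nr)"
proof (induction n)
  case 0
  then show ?case using assms by (simp add: step_S keep_simps)
next
  case (Suc n)
  have "step S (Rew b, t0 # (t1, int (Suc n)) # (zc, int (Suc n)) # ms @ (tn, j + int (Suc n)) # nr)
      = (Rew b, t0 # (t1, int n) # (zc, int n) # ms @ (tn, j + int n) # nr)"
    using assms by (auto simp: step_S keep_simps)
  with Suc show ?case unfolding funpow_Suc_right[of "Suc n"] by simp
qed

fun write_word :: "(int \<Rightarrow> sym) \<Rightarrow> int \<Rightarrow> 'b list \<Rightarrow> (int \<Rightarrow> sym)" where
  "write_word t j [] = t"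
| "write_word t j (x # w) = write_word (t(j := SN (letter N x))) (j + 1) w"

lemma write_word_nth:
  "write_word t j w i = (if j \<le> i \<and> i < j + int (length w) then SN (letter N (w ! nat (i - j))) else t i)"
proof (induction w arbitrary: t j)
  case (Cons x w)
  have "nat (i - j) = Suc (nat (i - (j + 1)))" if "j + 1 \<le> i" using that by linarith
  then show ?case by (auto simp: Cons.IH)
qed auto

lemma copy:
  assumes "length ms = ntapes M - 2" "Suc (length nr) = ntapes N"
    "\<forall>i<length w. dM (t1 (g + int i)) = oletter M (w ! i)"
    "dM (t1 (g + int (length w))) \<notin> range (oletter M)"
  shows "(step S ^^ Suc (length w)) (Copy b, t0 # (t1, g) # (zc, g) # ms @ (tn, j) # nr) =
    (Rew b, t0 # (t1, g + int (length w)) # (zc, g + int (length w)) # ms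
      @ (write_word tn j w, j + int (length w)) # nr)"
  using assms(3,4)
proof (induction w arbitrary: g tn j)
  case Nil
  then show ?case using assms(1,2) by (simp add: step_S keep_simps)
next
  case (Cons x w)
  have "dM (t1 g) = oletter M x" using Cons.prems(1)[rule_format, of 0] by simp
  then have "step S (Copy b, t0 # (t1, g) # (zc, g) # ms @ (tn, j) # nr)
    = (Copy b, t0 # (t1, g + 1) # (zc, g + 1) # ms @ (tn(j := SN (letter N x)), j + 1) # nr)"
    using assms(1,2) inj_oletter by (simp add: step_S keep_simps)
  moreover have "\<forall>i<length w. dM (t1 (g + 1 + int i)) = oletter M (w ! i)"
    using Cons.prems(1)[rule_format, of "Suc i" for i] by (auto simp: add.assoc)
  moreover have "dM (t1 (g + 1 + int (length w))) \<notin> range (oletter M)"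
    using Cons.prems(2) by (simp add: add.assoc)
  ultimately show ?case
    using Cons.IH[of "g + 1" "tn(j := SN (letter N x))" "j + 1"]
    unfolding list.size funpow_Suc_right[of "length w + Suc 0"] by (simp add: add.assoc del: funpow.simps fun_upd_apply)
qed

lemma run_step:
  assumes "length ms = ntapes M - 2" "valid N (p, us)" "list_all2 (embeds (blank N) n) us ns"
    "p \<noteq> accept N" "p \<noteq> reject N" "step N (p, us) = (p', us')"
  shows "\<exists>ns'. step S (Run p b, t0 # t1 # z # ms @ ns) = (Run p' b, t0 # t1 # z # ms @ ns') \<and>
    list_all2 (embeds (blank N) (Suc n)) us' ns'"
proof -
  have l: "length us = ntapes N" "length ns = ntapes N" "p \<in> states N"
    using assms(2) list_all2_lengthD[OF assms(3)] by (auto simp: valid_def)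
  have "map read us = map (dN \<circ> read) ns"
    using assms(3) by (induction rule: list_all2_induct) (auto simp: embeds_read)
  then have r: "map dN (map read ns) = map read us" by simp
  obtain q acts where d: "delta N p (map read us) = (q, acts)" by fastforce
  have len: "length acts = ntapes N" using deltaN(2)[OF l(3) valid_read[OF assms(2)] _ d] l by simp
  have "p' = q" "us' = map2 act acts us" using assms(4-6) d by (auto simp: read_eq step.simps)
  moreover have "list_all2 (embeds (blank N) (Suc n)) (map2 act acts us) (map2 act (map (map_prod SN id) acts) ns)"
  proof (rule list_all2_all_nthI)
    fix i assume "i < length (map2 act acts us)"
    then show "embeds (blank N) (Suc n) (map2 act acts us ! i) (map2 act (map (map_prod SN id) acts) ns ! i)"
      using len l list_all2_nthD2[OF assms(3), of i] embeds_act by simp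
  qed (use l len in simp)
  moreover have "step S (Run p b, t0 # t1 # z # ms @ ns)
      = (Run q b, t0 # t1 # z # ms @ map2 act (map (map_prod SN id) acts) ns)"
    using assms(1,4,5) l len d r by (simp add: step_S keep_simps del: map_map)
  ultimately show ?thesis by blast
qed

text \<open>The count is k \<le> m because a halted N stays put under \<open>step N\<close>, whereas
  the simulating machine would go on to erase; its run is cut off at that moment.\<close>

lemma run:
  assumes "length ms = ntapes M - 2" "valid N (p, us)" "list_all2 (embeds (blank N) n) us ns"
  shows "\<exists>k\<le>m. \<exists>ns'. (step S ^^ k) (Run p b, t0 # t1 # z # ms @ ns)
      = (Run (fst ((step N ^^ m) (p, us))) b, t0 # t1 # z # ms @ ns') \<and>
    list_all2 (embeds (blank N) (n + m)) (snd ((step N ^^ m) (p, us))) ns'"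
proof (induction m)
  case 0
  then show ?case using assms by auto
next
  case (Suc m)
  obtain p' us' where c: "(step N ^^ m) (p, us) = (p', us')" by fastforce
  obtain k ns' where k: "k \<le> m" "(step S ^^ k) (Run p b, t0 # t1 # z # ms @ ns) = (Run p' b, t0 # t1 # z # ms @ ns')"
    "list_all2 (embeds (blank N) (n + m)) us' ns'" using Suc c by auto
  have v: "valid N (p', us')"
    unfolding c[symmetric] using assms(2) valid_step[OF wfN] by (induction m) auto
  show ?case
  proof (cases "p' = accept N \<or> p' = reject N")
    case True
    then have "step N (p', us') = (p', us')" by (auto simp: step.simps)
    moreover have "list_all2 (embeds (blank N) (n + Suc m)) us' ns'"
      using k(3) by (rule list_all2_mono) (erule embeds_mono, simp)
    ultimately show ?thesis using k c by (intro exI[of _ k]) auto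
  next
    case False
    obtain p'' us'' where s: "step N (p', us') = (p'', us'')" by fastforce
    obtain ns'' where "step S (Run p' b, t0 # t1 # z # ms @ ns') = (Run p'' b, t0 # t1 # z # ms @ ns'')"
      "list_all2 (embeds (blank N) (Suc (n + m))) us'' ns''"
      using run_step[OF assms(1) v k(3) _ _ s] False by blast
    then show ?thesis using k c s by (intro exI[of _ "Suc k"]) auto
  qed
qed

text \<open>Induction on the largest distance \<open>n\<close> of a head to the right end of its
  interval. The bound \<open>m\<close> on the lengths is only carried along for the sweep to the
  left. The last step moves every head back by one, onto the last cell to be erased.\<close>

lemma clean_right:
  assumes ms: "length ms = ntapes M - 2" and "length ns = ntapes N"
    "\<forall>(t, h) \<in> set ns. \<exists>lo hi. dirty t = {lo..<hi} \<and> lo < hi \<and> lo \<le> h \<and> h \<le> hi \<and>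
      hi - h \<le> int n \<and> hi - lo \<le> int m"
  shows "\<exists>k\<le>Suc n. \<exists>ns'. length ns' = ntapes N \<and>
    (step S ^^ k) (Cl1 a b, t0 # t1 # z # ms @ ns) = (Cl2 a b, t0 # t1 # z # ms @ ns') \<and>
    (\<forall>(t, h) \<in> set ns'. \<exists>lo. dirty t = {lo..h} \<and> lo - 1 \<le> h \<and> h - lo + 1 \<le> int m)"
  using assms(2,3)
proof (induction n arbitrary: ns)
  have stop: "step S (Cl1 a b, t0 # t1 # z # ms @ ns) = (Cl2 a b, t0 # t1 # z # ms @ map (\<lambda>(t, h). (t, h - 1)) ns)"
    if "length ns = ntapes N" "set (map read ns) \<subseteq> {Bl}" for ns
    using that ms by (auto simp: step_S keep_simps acts_map simp del: map_map)
  have stopped: "\<forall>(t, h) \<in> set (map (\<lambda>(t, h). (t, h - 1)) ns).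
      \<exists>lo. dirty t = {lo..h} \<and> lo - 1 \<le> h \<and> h - lo + 1 \<le> int m"
    if ns: "\<forall>(t, h) \<in> set ns. \<exists>lo hi. dirty t = {lo..<hi} \<and> lo < hi \<and> lo \<le> h \<and> h \<le> hi \<and>
        hi - h \<le> int j \<and> hi - lo \<le> int m"
      "set (map read ns) \<subseteq> {Bl}" for ns j
  proof clarify
    fix t h assume "(t, h) \<in> set (map (\<lambda>(t, h). (t, h - 1)) ns)"
    then have x: "(t, h + 1) \<in> set ns" by auto
    then obtain lo hi where *: "dirty t = {lo..<hi}" "lo < hi" "lo \<le> h + 1" "h + 1 \<le> hi" "hi - lo \<le> int m"
      using ns(1) by blast
    moreover have "t (h + 1) = Bl" using ns(2) x by auto
    ultimately have "h + 1 = hi" by (simp add: Bl_iff)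
    then have "{lo..<hi} = {lo..h}" "lo - 1 \<le> h" "h - lo + 1 \<le> int m" using *(2,5) by auto
    then show "\<exists>lo. dirty t = {lo..h} \<and> lo - 1 \<le> h \<and> h - lo + 1 \<le> int m"
      using *(1) by metis
  qed
  {
    case 0
    have "read x = Bl" if x: "x \<in> set ns" for x
    proof (cases x)
      case (Pair t h)
      then obtain lo hi where "dirty t = {lo..<hi}" "h \<le> hi" "hi - h \<le> 0" using 0(2) x by auto
      then show ?thesis using Pair by (simp add: Bl_iff)
    qed
    then have Bl: "set (map read ns) \<subseteq> {Bl}" by auto
    show ?case
      using stop[OF 0(1) Bl] 0(1) stopped[OF 0(2) Bl]
      by (intro exI[of _ "1::nat"] conjI exI[of _ "map (\<lambda>(t, h). (t, h - 1)) ns"]) simp_all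
  next
    case (Suc n)
    show ?case
    proof (cases "set (map read ns) \<subseteq> {Bl}")
      case True
      show ?thesis
        using stop[OF Suc.prems(1) True] Suc.prems(1) stopped[OF Suc.prems(2) True]
        by (intro exI[of _ "1::nat"] conjI exI[of _ "map (\<lambda>(t, h). (t, h - 1)) ns"]) simp_all
    next
      case False
      define g where "g = (\<lambda>(t :: int \<Rightarrow> sym, h). (t, if t h = Bl then h else h + 1))"
      have st: "step S (Cl1 a b, t0 # t1 # z # ms @ ns) = (Cl1 a b, t0 # t1 # z # ms @ map g ns)"
        using False Suc.prems ms by (auto simp: step_S keep_simps acts_map g_def fun_upd_idem simp del: map_map)
      have "\<exists>lo hi. dirty t = {lo..<hi} \<and> lo < hi \<and> lo \<le> h' \<and> h' \<le> hi \<and>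
        hi - h' \<le> int n \<and> hi - lo \<le> int m" if x: "(t, h) \<in> set ns" and h': "h' = (if t h = Bl then h else h + 1)" for t h h'
      proof -
        obtain lo hi where *: "dirty t = {lo..<hi}" "lo < hi" "lo \<le> h" "h \<le> hi"
          "hi - h \<le> int (Suc n)" "hi - lo \<le> int m"
          using Suc.prems(2) x by blast
        then have "t h = Bl \<longleftrightarrow> h = hi" by (auto simp: Bl_iff)
        with * h' show ?thesis by (intro exI[of _ lo] exI[of _ hi]) auto
      qed
      then have "\<forall>(t, h) \<in> set (map g ns). \<exists>lo hi. dirty t = {lo..<hi} \<and> lo < hi \<and> lo \<le> h \<and> h \<le> hi \<and>
          hi - h \<le> int n \<and> hi - lo \<le> int m"
        by (auto simp only: g_def set_map split: prod.splits)
      then obtain k ns' where "k \<le> Suc n" "length ns' = ntapes N"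
        "(step S ^^ k) (Cl1 a b, t0 # t1 # z # ms @ map g ns) = (Cl2 a b, t0 # t1 # z # ms @ ns')"
        "\<forall>(t, h) \<in> set ns'. \<exists>lo. dirty t = {lo..h} \<and> lo - 1 \<le> h \<and> h - lo + 1 \<le> int m"
        using Suc.IH[of "map g ns"] Suc.prems(1) by auto
      then show ?thesis using st
        by (intro exI[of _ "Suc k"]) (auto simp: funpow_Suc_right simp del: funpow.simps)
    qed
  }
qed

text \<open>The region always ends at the head, so a head that reads \<open>Bl\<close> certifies
  that its whole tape is blank, and inspecting the scanned cells suffices to stop.\<close>

lemma clean_left:
  assumes ms: "length ms = ntapes M - 2" and "length ns = ntapes N"
    "\<forall>(t, h) \<in> set ns. \<exists>lo. dirty t = {lo..h} \<and> lo - 1 \<le> h \<and> h - lo + 1 \<le> int n"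
  shows "\<exists>k\<le>Suc n. \<exists>ns'. length ns' = ntapes N \<and>
    (step S ^^ k) (Cl2 a b, t0 # t1 # z # ms @ ns) =
      (Sim (if a then yes M else no M) b, t0 # t1 # z # ms @ ns') \<and>
    (\<forall>x \<in> set ns'. fst x = (\<lambda>_. Bl))"
  using assms(2,3)
proof (induction n arbitrary: ns)
  have stop: "step S (Cl2 a b, t0 # t1 # z # ms @ ns) = (Sim (if a then yes M else no M) b, t0 # t1 # z # ms @ ns)"
    if "length ns = ntapes N" "set (map read ns) \<subseteq> {Bl}" for ns
    using that ms by (auto simp: step_S keep_simps)
  have stopped: "\<forall>x \<in> set ns. fst x = (\<lambda>_. Bl)"
    if ns: "\<forall>(t, h) \<in> set ns. \<exists>lo. dirty t = {lo..h} \<and> lo - 1 \<le> h \<and> h - lo + 1 \<le> int j"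
      "set (map read ns) \<subseteq> {Bl}" for ns j
  proof
    fix x assume x: "x \<in> set ns"
    obtain t h where xt: "x = (t, h)" by (cases x)
    then obtain lo where "dirty t = {lo..h}" using ns(1) x by blast
    moreover have "t h = Bl" using ns(2) x xt by auto
    ultimately have "dirty t = {}" by (auto simp: Bl_iff)
    then show "fst x = (\<lambda>_. Bl)" using xt by (auto simp: dirty_def)
  qed
  {
    case 0
    have "read x = Bl" if x: "x \<in> set ns" for x
    proof (cases x)
      case (Pair t h)
      then obtain lo where "dirty t = {lo..h}" "h - lo + 1 \<le> 0" using 0(2) x by auto
      then show ?thesis using Pair by (simp add: Bl_iff)
    qed
    then have Bl: "set (map read ns) \<subseteq> {Bl}" by auto
    show ?case
      using stop[OF 0(1) Bl] 0(1) stopped[OF 0(2) Bl]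
      by (intro exI[of _ "1::nat"] conjI exI[of _ ns]) simp_all
  next
    case (Suc n)
    show ?case
    proof (cases "set (map read ns) \<subseteq> {Bl}")
      case True
      show ?thesis
        using stop[OF Suc.prems(1) True] Suc.prems(1) stopped[OF Suc.prems(2) True]
        by (intro exI[of _ "1::nat"] conjI exI[of _ ns]) simp_all
    next
      case False
      define g where "g = (\<lambda>(t :: int \<Rightarrow> sym, h). (t(h := Bl), if t h = Bl then h else h - 1))"
      have st: "step S (Cl2 a b, t0 # t1 # z # ms @ ns) = (Cl2 a b, t0 # t1 # z # ms @ map g ns)"
        using False Suc.prems ms by (auto simp: step_S keep_simps acts_map g_def fun_upd_idem simp del: map_map)
      have "\<exists>lo. dirty (t(h := Bl)) = {lo..h'} \<and> lo - 1 \<le> h' \<and> h' - lo + 1 \<le> int n"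
        if x: "(t, h) \<in> set ns" and h': "h' = (if t h = Bl then h else h - 1)" for t h h'
      proof -
        obtain lo where *: "dirty t = {lo..h}" "lo - 1 \<le> h" "h - lo + 1 \<le> int (Suc n)"
          using Suc.prems(2) x by blast
        have "t h = Bl \<longleftrightarrow> h = lo - 1" using *(1,2) by (auto simp: Bl_iff)
        then have "{lo..h} - {h} = {lo..h'}" "lo - 1 \<le> h'" "h' - lo + 1 \<le> int n"
          using *(2,3) h' by (auto split: if_splits)
        moreover have "dirty (t(h := Bl)) = dirty t - {h}" by (auto simp: dirty_def)
        ultimately show ?thesis using *(1) by metis
      qed
      then have "\<forall>(t, h) \<in> set (map g ns). \<exists>lo. dirty t = {lo..h} \<and> lo - 1 \<le> h \<and> h - lo + 1 \<le> int n"
        by (auto simp only: g_def set_map split: prod.splits)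
      then obtain k ns' where "k \<le> Suc n" "length ns' = ntapes N"
        "(step S ^^ k) (Cl2 a b, t0 # t1 # z # ms @ map g ns) =
          (Sim (if a then yes M else no M) b, t0 # t1 # z # ms @ ns')"
        "\<forall>x \<in> set ns'. fst x = (\<lambda>_. Bl)"
        using Suc.IH[of "map g ns"] Suc.prems(1) by auto
      then show ?thesis using st
        by (intro exI[of _ "Suc k"]) (auto simp: funpow_Suc_right simp del: funpow.simps)
    qed
  }
qed

section \<open>Cost of a query and of the whole simulation\<close>

definition reach :: "nat \<Rightarrow> (st, sym) config \<Rightarrow> (st, sym) config \<Rightarrow> bool" where
  "reach n c d \<longleftrightarrow> (\<exists>k\<le>n. (step S ^^ k) c = d)"

lemma reach_trans:
  assumes "reach m c d" "reach n d e" shows "reach (m + n) c e"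
proof -
  obtain i j where "i \<le> m" "(step S ^^ i) c = d" "j \<le> n" "(step S ^^ j) d = e"
    using assms unfolding reach_def by blast
  then have "j + i \<le> m + n" "(step S ^^ (j + i)) c = e" by (auto simp: funpow_add)
  then show ?thesis unfolding reach_def by blast
qed

lemma reach_mono: "reach m c d \<Longrightarrow> m \<le> n \<Longrightarrow> reach n c d"
proof -
  assume "reach m c d" "m \<le> n"
  then obtain k where "k \<le> m" "(step S ^^ k) c = d" unfolding reach_def by blast
  moreover from this \<open>m \<le> n\<close> have "k \<le> n" by simp
  ultimately show ?thesis unfolding reach_def by blast
qed

lemma reach_step: "step S c = d \<Longrightarrow> reach 1 c d"
  unfolding reach_def by (intro exI[of _ 1]) simp

lemma init_embeds:
  assumes "Suc (length nr) = ntapes N" "\<forall>x \<in> set nr. fst x = (\<lambda>_. Bl)"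
  shows "list_all2 (embeds (blank N) (length w)) (snd (init N w)) ((write_word (\<lambda>_. Bl) j w, j) # nr)"
proof -
  have "dirty (write_word (\<lambda>_. Bl) j w) = {j..<j + int (length w)}"
    by (auto simp: dirty_def write_word_nth)
  then have "swept (length w) (write_word (\<lambda>_. Bl) j w, j)"
    unfolding swept.simps by (intro exI[of _ j] exI[of _ "j + int (length w)"]) simp
  then have 1: "embeds (blank N) (length w)
      (\<lambda>i. if 0 \<le> i \<and> i < int (length w) then letter N (w ! nat i) else blank N, 0)
      (write_word (\<lambda>_. Bl) j w, j)"
    by (simp add: write_word_nth del: swept.simps)
  have 2: "embeds (blank N) (length w) (\<lambda>_. blank N, 0) x" if "x \<in> set nr" for x
  proof (cases x)
    case (Pair t h)
    then have "t = (\<lambda>_. Bl)" using assms(2) that by auto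
    moreover have "dirty (\<lambda>_. Bl) = {h..<h}" by (simp add: dirty_def)
    then have "swept (length w) (\<lambda>_. Bl, h)"
      unfolding swept.simps by (intro exI[of _ h]) simp
    ultimately show ?thesis using Pair by (simp del: swept.simps)
  qed
  have "list_all2 (embeds (blank N) (length w)) (replicate (ntapes N - 1) (\<lambda>_. blank N, 0)) nr"
    by (rule list_all2_all_nthI) (use assms 2 in auto)
  with 1 show ?thesis unfolding init_def by simp
qed

text \<open>With d the distance of the query head from the origin, the phases take at most 2 d + 4
  |w| + 3 m + 10 steps: seeking and returning cost d each, copying, rewinding and the two sweeps |w|
  each, the run and the two sweeps m each.\<close>

lemma answer:
  assumes l: "length ms = ntapes M - 2" "length ns = ntapes N"
    and ns: "\<forall>x \<in> set ns. fst x = (\<lambda>_. Bl)"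
    and h: "h < 0 \<longrightarrow> b" "0 < h \<longrightarrow> \<not> b" "\<bar>h\<bar> \<le> int n"
    and w: "queried M (\<lambda>i. dM (t1 i)) w" "length w \<le> n"
    and N: "m \<le> T" "fst ((step N ^^ m) (init N w)) = (if w \<in> B then accept N else reject N)"
  shows "\<exists>ns'. length ns' = ntapes N \<and> (\<forall>x \<in> set ns'. fst x = (\<lambda>_. Bl)) \<and>
    reach (6 * n + 3 * T + 20)
      (Sim (query M) b, t0 # (t1, h) # (\<lambda>i. Zs (i = 0) False, h) # ms @ ns)
      (Sim (if w \<in> B then yes M else no M) b, t0 # (t1, h) # (\<lambda>i. Zs (i = 0) False, h) # ms @ ns')"
proof -
  define d where "d = nat \<bar>h\<bar>"
  have hd: "h = (if b then - int d else int d)" using h by (auto simp: d_def)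
  have dn: "d \<le> n" using h(3) by (simp add: d_def)
  define zc where "zc = (\<lambda>i. Zs (i = 0) (i = h))"
  obtain x nr where x: "ns = x # nr" using l(2) ntapesN by (cases ns) auto
  then obtain j where n0: "ns = (\<lambda>_. Bl, j) # nr" using ns by (cases x) auto
  have nr: "Suc (length nr) = ntapes N" "\<forall>x \<in> set nr. fst x = (\<lambda>_. Bl)" using l(2) ns n0 by auto
  have q: "query M \<noteq> accept M" "query M \<noteq> reject M" using wfM by (auto simp: wf_otm_def)
  have z1: "(\<lambda>i. Zs (i = 0) False)(h := Zs (h = 0) True) = zc" by (auto simp: zc_def)
  have z2: "zc(h := Zs (origin (zc h)) False) = (\<lambda>i. Zs (i = 0) False)" by (auto simp: zc_def)
  have "step S (Sim (query M) b, t0 # (t1, h) # (\<lambda>i. Zs (i = 0) False, h) # ms @ ns)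
      = (Seek b, t0 # (t1, h) # (zc, h) # ms @ ns)"
    using l q z1 by (simp add: step_S keep_simps del: fun_upd_apply)
  then have 1: "reach 1 (Sim (query M) b, t0 # (t1, h) # (\<lambda>i. Zs (i = 0) False, h) # ms @ ns)
      (Seek b, t0 # (t1, h) # (zc, h) # ms @ ns)" by (rule reach_step)
  have 2: "reach (Suc d) (Seek b, t0 # (t1, h) # (zc, h) # ms @ ns) (Copy b, t0 # (t1, 0) # (zc, 0) # ms @ ns)"
    unfolding reach_def using seek[OF l _ hd, of zc t0 t1] by (intro exI[of _ "Suc d"]) (simp add: zc_def)
  have 3: "reach (Suc (length w)) (Copy b, t0 # (t1, 0) # (zc, 0) # ms @ ns)
     (Rew b, t0 # (t1, int (length w)) # (zc, int (length w)) # ms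
      @ (write_word (\<lambda>_. Bl) j w, j + int (length w)) # nr)"
    unfolding reach_def using copy[OF l(1) nr(1), of w t1 0 b t0 zc "\<lambda>_. Bl" j] w(1)
    by (intro exI[of _ "Suc (length w)"]) (simp add: queried_def n0)
  have 4: "reach (Suc (length w)) (Rew b, t0 # (t1, int (length w)) # (zc, int (length w)) # ms
      @ (write_word (\<lambda>_. Bl) j w, j + int (length w)) # nr)
     (Back b, t0 # (t1, 0) # (zc, 0) # ms @ (write_word (\<lambda>_. Bl) j w, j) # nr)"
    unfolding reach_def using rewind[OF l(1) nr(1), of zc "length w" b t0 t1]
    by (intro exI[of _ "Suc (length w)"]) (simp add: zc_def)
  define ns1 where "ns1 = (write_word (\<lambda>_. Bl) j w, j) # nr"
  have l1: "length ns1 = ntapes N" using nr by (simp add: ns1_def)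
  have 5: "reach (Suc d) (Back b, t0 # (t1, 0) # (zc, 0) # ms @ ns1)
     (Run (start N) b, t0 # (t1, h) # (\<lambda>i. Zs (i = 0) False, h) # ms @ ns1)"
    unfolding reach_def using go_back[OF l(1) l1, of zc h 0 b d t0 t1] hd z2
    by (intro exI[of _ "Suc d"]) (simp add: zc_def)
  let ?c = "\<lambda>q ns. (q, t0 # (t1, h) # (\<lambda>i. Zs (i = 0) False, h) # ms @ ns)"
  define p where "p = (if w \<in> B then accept N else reject N)"
  have p: "(p = accept N) = (w \<in> B)" "p = accept N \<or> p = reject N"
    using wfN by (auto simp: p_def wf_tm_def)
  have ini: "(start N, snd (init N w)) = init N w" by (simp add: init_def)
  obtain k ns2 where k: "k \<le> m" "(step S ^^ k) (?c (Run (start N) b) ns1) = ?c (Run p b) ns2"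
    and e: "list_all2 (embeds (blank N) (length w + m)) (snd ((step N ^^ m) (init N w))) ns2"
    using run[OF l(1), of "start N" "snd (init N w)" "length w" ns1 m b t0 "(t1, h)" "(\<lambda>i. Zs (i = 0) False, h)",
        unfolded ini, OF valid_init[OF wfN] init_embeds[OF nr, of w j, folded ns1_def]] N(2)
    unfolding p_def by auto
  have 6: "reach m (?c (Run (start N) b) ns1) (?c (Run p b) ns2)"
    using k unfolding reach_def by blast
  have v: "valid N ((step N ^^ m) (init N w))"
    using valid_init[OF wfN] valid_step[OF wfN] by (induction m) auto
  have l2: "length ns2 = ntapes N" using list_all2_lengthD[OF e] v by (simp add: valid_def)
  have sw: "swept (length w + m) x" if x: "x \<in> set ns2" for x
  proof -
    obtain i where i: "i < length ns2" "x = ns2 ! i" using x unfolding in_set_conv_nth by blast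
    then have "embeds (blank N) (length w + m) (snd ((step N ^^ m) (init N w)) ! i) x"
      using list_all2_nthD2[OF e] by simp
    then show ?thesis
      by (cases x; cases "snd ((step N ^^ m) (init N w)) ! i") (simp del: swept.simps)
  qed
  define ns3 where "ns3 = map (\<lambda>t. act (SN (dN (read t)), Stay) t) ns2"
  have l3: "length ns3 = ntapes N" using l2 by (simp add: ns3_def)
  have "keep (map (\<lambda>s. SN (dN s)) ss) = map (\<lambda>s. (SN (dN s), Stay)) ss" for ss
    by (simp add: keep_def)
  then have "step S (?c (Run p b) ns2) = ?c (Cl1 (w \<in> B) b) ns3"
    using l l2 p by (simp add: step_S keep_simps ns3_def acts_map fun_upd_idem del: map_map)
  then have 7: "reach 1 (?c (Run p b) ns2) (?c (Cl1 (w \<in> B) b) ns3)" by (rule reach_step)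
  have mk: "\<forall>(t, h) \<in> set ns3. \<exists>lo hi. dirty t = {lo..<hi} \<and> lo < hi \<and> lo \<le> h \<and> h \<le> hi \<and>
      hi - h \<le> int (Suc (length w + m)) \<and> hi - lo \<le> int (Suc (length w + m))"
  proof clarify
    fix t h assume "(t, h) \<in> set ns3"
    then obtain x where "x \<in> set ns2" "act (SN (dN (read x)), Stay) x = (t, h)"
      by (auto simp: ns3_def simp del: act.simps)
    with swept_mark[OF sw] show "\<exists>lo hi. dirty t = {lo..<hi} \<and> lo < hi \<and> lo \<le> h \<and> h \<le> hi \<and>
      hi - h \<le> int (Suc (length w + m)) \<and> hi - lo \<le> int (Suc (length w + m))" by blast
  qed
  obtain ns4 where l4: "length ns4 = ntapes N"
    and 8: "reach (Suc (Suc (length w + m))) (?c (Cl1 (w \<in> B) b) ns3) (?c (Cl2 (w \<in> B) b) ns4)"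
    and c4: "\<forall>(t, h) \<in> set ns4. \<exists>lo. dirty t = {lo..h} \<and> lo - 1 \<le> h \<and> h - lo + 1 \<le> int (Suc (length w + m))"
    using clean_right[OF l(1) l3 mk] unfolding reach_def by meson
  obtain ns5 where l5: "length ns5 = ntapes N" "\<forall>x \<in> set ns5. fst x = (\<lambda>_. Bl)"
    and 9: "reach (Suc (Suc (length w + m))) (?c (Cl2 (w \<in> B) b) ns4)
      (?c (Sim (if w \<in> B then yes M else no M) b) ns5)"
    using clean_left[OF l(1) l4 c4] unfolding reach_def by meson
  note 1 2 3 4[folded ns1_def] 5 6 7 8 9
  note this(1)[THEN reach_trans, OF this(2), THEN reach_trans, OF this(3), THEN reach_trans, OF this(4),
      THEN reach_trans, OF this(5), THEN reach_trans, OF this(6), THEN reach_trans, OF this(7),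
      THEN reach_trans, OF this(8), THEN reach_trans, OF this(9)]
  then have "reach (6 * n + 3 * T + 20) (?c (Sim (query M) b) ns) (?c (Sim (if w \<in> B then yes M else no M) b) ns5)"
    by (rule reach_mono) (use w(2) N(1) dn in linarith)
  with l5 show ?thesis by blast
qed

inductive simulates :: "(nat, nat) config \<Rightarrow> (st, sym) config \<Rightarrow> bool" where
  simulatesI: "length ns = ntapes N \<Longrightarrow> \<forall>x \<in> set ns. fst x = (\<lambda>_. Bl) \<Longrightarrow> h < 0 \<longrightarrow> b \<Longrightarrow> 0 < h \<longrightarrow> \<not> b \<Longrightarrow>
    simulates (q, map (decT (blank M)) (t0 # (t1, h) # ms))
      (Sim q b, t0 # (t1, h) # (\<lambda>i. Zs (i = 0) False, h) # ms @ ns)"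

lemma simulates_step:
  assumes "simulates c d" and "valid M c" and q: "fst c \<noteq> accept M" "fst c \<noteq> reject M" "fst c \<noteq> query M"
  shows "simulates (step M c) (step S d)"
  using assms(1)
proof (cases rule: simulates.cases)
  case (simulatesI ns h b q t0 t1 ms)
  define us where "us = map (decT (blank M)) (t0 # (t1, h) # ms)"
  have c: "c = (q, us)" using simulatesI(1) by (simp only: us_def)
  note v = assms(2)[unfolded c]
  have lm: "length ms = ntapes M - 2" "q \<in> states M" "length us = ntapes M" using v by (auto simp: valid_def us_def)
  obtain q' as where dl: "delta M q (map read us) = (q', as)" by fastforce
  have "length as = ntapes M" using deltaM(2)[OF lm(2) valid_read[OF v] _ dl] lm by simp
  then obtain a0 s1 d1 ar where as: "as = a0 # (s1, d1) # ar" "length ar = ntapes M - 2"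
    using ntapesM by (cases as; cases "tl as") auto
  have rd: "map read us = map dM (read t0 # t1 h # map read ms)"
    unfolding us_def by (simp add: decT_read)
  define b' where "b' = (if h = 0 then d1 = Left else b)"
  have sS: "step S d = (Sim q' b', act (map_prod SM id a0) t0 # (t1(h := SM s1), h + shift d1)
      # (\<lambda>i. Zs (i = 0) False, h + shift d1) # map2 act (map (map_prod SM id) ar) ms @ ns)"
    unfolding simulatesI(2) using lm(1) simulatesI(3) q c dl[unfolded rd] as
    by (simp add: step_S keep_simps b'_def numeral_2_eq_2 fun_upd_idem del: fun_upd_apply)
  have "step M c = (q', map2 act as us)"
    unfolding c using q c dl by (simp add: step.simps read_eq)
  also have "map2 act as us = map (decT (blank M)) (map2 act (map (map_prod SM id) as) (t0 # (t1, h) # ms))"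
    unfolding us_def by (rule decT_acts[symmetric])
  also have "map2 act (map (map_prod SM id) as) (t0 # (t1, h) # ms) = act (map_prod SM id a0) t0
      # (t1(h := SM s1), h + shift d1) # map2 act (map (map_prod SM id) ar) ms"
    by (simp add: as del: fun_upd_apply)
  finally have sM: "step M c = (q', map (decT (blank M)) (act (map_prod SM id a0) t0
      # (t1(h := SM s1), h + shift d1) # map2 act (map (map_prod SM id) ar) ms))" .
  have "h + shift d1 < 0 \<longrightarrow> b'" "0 < h + shift d1 \<longrightarrow> \<not> b'"
    using simulatesI(5,6) by (cases d1; auto simp: b'_def)+
  then show ?thesis
    unfolding sS sM by (rule simulates.simulatesI[OF simulatesI(3,4)])
qed

lemma simulates_query:
  assumes "simulates c d" and v: "valid M c" and q: "fst c = query M"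
    and near: "near (blank M) n (snd c ! 1)"
    and N: "\<And>w. length w \<le> n \<Longrightarrow>
      \<exists>m\<le>T. fst ((step N ^^ m) (init N w)) = (if w \<in> B then accept N else reject N)"
  shows "\<exists>e. reach (6 * n + 3 * T + 20) d e \<and> simulates (ostep B M c) e"
  using assms(1)
proof (cases rule: simulates.cases)
  case (simulatesI ns h b q' t0 t1 ms)
  have q': "q' = query M" using q simulatesI(1) by simp
  have lm: "length ms = ntapes M - 2" using v simulatesI(1) by (auto simp: valid_def)
  have nr: "near (blank M) n (\<lambda>i. dM (t1 i), h)" using near simulatesI(1) by simp
  then have hn: "\<bar>h\<bar> \<le> int n" by simp
  have "blank M \<notin> range (oletter M)" using wfM by (auto simp: wf_otm_def)
  from queried_exists[OF this nr] obtain w where w: "queried M (\<lambda>i. dM (t1 i)) w" "length w \<le> n" .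
  have "(\<exists>w\<in>B. queried M (\<lambda>i. dM (t1 i)) w) \<longleftrightarrow> w \<in> B"
    using queried_unique[OF inj_oletter w(1)] w(1) by blast
  then have o: "ostep B M c = (if w \<in> B then yes M else no M, map (decT (blank M)) (t0 # (t1, h) # ms))"
    unfolding simulatesI(1) q' by simp
  obtain m where "m \<le> T" "fst ((step N ^^ m) (init N w)) = (if w \<in> B then accept N else reject N)"
    using N[OF w(2)] by blast
  from answer[OF lm simulatesI(3-6) hn w this] obtain ns' where
    ns': "length ns' = ntapes N" "\<forall>x \<in> set ns'. fst x = (\<lambda>_. Bl)"
    and r: "reach (6 * n + 3 * T + 20) d
      (Sim (if w \<in> B then yes M else no M) b, t0 # (t1, h) # (\<lambda>i. Zs (i = 0) False, h) # ms @ ns')"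
    unfolding simulatesI(2) q' by blast
  have "simulates (ostep B M c)
      (Sim (if w \<in> B then yes M else no M) b, t0 # (t1, h) # (\<lambda>i. Zs (i = 0) False, h) # ms @ ns')"
    unfolding o by (rule simulates.simulatesI[OF ns' simulatesI(5,6)])
  with r show ?thesis by blast
qed

lemma simulates_init: "\<exists>e. reach 1 (init S w) e \<and> simulates (init M w) e"
proof -
  define t0 where "t0 = (\<lambda>i. if 0 \<le> i \<and> i < int (length w) then SM (letter M (w ! nat i)) else Bl, 0 :: int)"
  define x :: "sym tape" where "x = (\<lambda>_. Bl, 0)"
  have "ntapes M + ntapes N = Suc (Suc (ntapes M - 2 + ntapes N))" using ntapesM by simp
  then have "replicate (ntapes M + ntapes N) x = x # x # replicate (ntapes M - 2) x @ replicate (ntapes N) x"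
    by (simp only: replicate_Suc replicate_add)
  then have i: "init S w = (Ini, t0 # x # x # replicate (ntapes M - 2) x @ replicate (ntapes N) x)"
    unfolding init_def by (auto simp: S_def t0_def x_def fun_eq_iff)
  have z: "(\<lambda>_. Bl)(0 := Zs True False) = (\<lambda>i :: int. Zs (i = 0) False)" by auto
  have "step S (init S w) = (Sim (start M) False, t0 # x # (\<lambda>i. Zs (i = 0) False, 0)
      # replicate (ntapes M - 2) x @ replicate (ntapes N) x)"
    unfolding i using z by (simp add: step_S keep_simps x_def fun_upd_idem del: map_replicate fun_upd_apply)
  moreover have "ntapes M - 1 = Suc (ntapes M - 2)" using ntapesM by simp
  then have iM: "init M w = (start M, map (decT (blank M)) (t0 # (\<lambda>_. Bl, 0) # replicate (ntapes M - 2) x))"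
    by (auto simp: init_def t0_def x_def)
  have "simulates (init M w) (Sim (start M) False, t0 # (\<lambda>_. Bl, 0) # (\<lambda>i. Zs (i = 0) False, 0)
      # replicate (ntapes M - 2) x @ replicate (ntapes N) x)"
    unfolding iM by (rule simulatesI) (auto simp: x_def)
  ultimately show ?thesis using reach_step unfolding x_def by blast
qed

text \<open>\<open>n\<close> plays the part of the time bound of M: within m \<le> n steps the query
  tape stays within distance n of the origin, so every query falls under the assumption on
  N.\<close>

lemma simulates_run:
  assumes N: "\<And>w. length w \<le> n \<Longrightarrow>
      \<exists>m\<le>T. fst ((step N ^^ m) (init N w)) = (if w \<in> B then accept N else reject N)"
    and "m \<le> n"
  shows "\<exists>e. reach (1 + m * (6 * n + 3 * T + 20)) (init S w) e \<and> simulates ((ostep B M ^^ m) (init M w)) e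
    \<and> valid M ((ostep B M ^^ m) (init M w)) \<and> near (blank M) m (snd ((ostep B M ^^ m) (init M w)) ! 1)"
  using assms(2)
proof (induction m)
  case 0
  have "near (blank M) 0 (snd (init M w) ! 1)" using ntapesM by (simp add: init_def)
  then show ?case using simulates_init valid_init[OF wfM_tm] by simp
next
  case (Suc m)
  then obtain e where r: "reach (1 + m * (6 * n + 3 * T + 20)) (init S w) e"
    and sim: "simulates ((ostep B M ^^ m) (init M w)) e"
    and v: "valid M ((ostep B M ^^ m) (init M w))" and nr: "near (blank M) m (snd ((ostep B M ^^ m) (init M w)) ! 1)"
    by auto
  obtain q us where c: "(ostep B M ^^ m) (init M w) = (q, us)" by fastforce
  have "\<exists>e'. reach (6 * n + 3 * T + 20) e e' \<and> simulates (ostep B M (q, us)) e'"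
  proof (cases "q = query M")
    case True
    have "near (blank M) n (us ! 1)" using near_mono[OF nr] Suc.prems c by simp
    then show ?thesis using simulates_query[OF sim v _ _ N] c True by simp
  next
    case nq: False
    then have o: "ostep B M (q, us) = step M (q, us)" by simp
    show ?thesis
    proof (cases "q = accept M \<or> q = reject M")
      case True
      then have "step M (q, us) = (q, us)" by (auto simp: step.simps)
      moreover have "reach (6 * n + 3 * T + 20) e e" unfolding reach_def by (intro exI[of _ 0]) simp
      moreover have "simulates (step M (q, us)) e" using sim c calculation(1) by simp
      ultimately show ?thesis unfolding o by blast
    next
      case False
      then have "simulates (step M (q, us)) (step S e)" using simulates_step[OF sim v] nq c by simp
      moreover have "reach (6 * n + 3 * T + 20) e (step S e)"
        by (rule reach_mono[OF reach_step[OF refl]]) simp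
      ultimately show ?thesis unfolding o by blast
    qed
  qed
  then obtain e' where e': "reach (6 * n + 3 * T + 20) e e'" "simulates (ostep B M (q, us)) e'" by blast
  have r': "reach (1 + Suc m * (6 * n + 3 * T + 20)) (init S w) e'"
    by (rule reach_mono[OF reach_trans[OF r e'(1)]]) simp
  have "(ostep B M ^^ Suc m) (init M w) = ostep B M (q, us)" using c by (simp del: ostep.simps)
  then show ?case
    using r' e'(2) valid_ostep[OF wfM v, of B] near_ostep[OF wfM v nr, of B] unfolding c by metis
qed

lemma reduction_DTime:
  assumes N: "\<And>w. \<exists>m\<le>u (length w). fst ((step N ^^ m) (init N w)) = (if w \<in> B then accept N else reject N)"
    and M: "\<And>w. \<exists>m\<le>f (length w). fst ((ostep B M ^^ m) (init M w)) = (if w \<in> A then accept M else reject M)"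
    and X: "\<And>n. f n \<le> X n" "\<And>n j. j \<le> f n \<Longrightarrow> u j \<le> X n" "\<And>n. 40 * (X n + 1) * (X n + 1) \<le> t n"
  shows "A \<in> DTime t"
proof (rule DTimeI[OF wf_S])
  fix w :: "'a list"
  define n where "n = f (length w)"
  define T where "T = X (length w)"
  have "\<exists>m\<le>T. fst ((step N ^^ m) (init N v)) = (if v \<in> B then accept N else reject N)" if "length v \<le> n" for v
    using N[of v] X(2)[of "length v" "length w"] that unfolding n_def T_def by (meson order_trans)
  note run = simulates_run[OF this]
  obtain m where m: "m \<le> n" "fst ((ostep B M ^^ m) (init M w)) = (if w \<in> A then accept M else reject M)"
    using M[of w] unfolding n_def by blast
  obtain e where r: "reach (1 + m * (6 * n + 3 * T + 20)) (init S w) e"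
    and sim: "simulates ((ostep B M ^^ m) (init M w)) e" and v: "valid M ((ostep B M ^^ m) (init M w))"
    using run[OF _ m(1)] by blast
  \<comment> \<open>One further step leads from a halting state of M, kept inside
    \<open>Sim\<close>, to \<open>Acc\<close> or \<open>Rej\<close>.\<close>
  have "fst (step S e) = (if w \<in> A then Acc else Rej)"
  proof -
    have "accept M \<noteq> reject M" using wfM_tm by (simp add: wf_tm_def)
    with sim show ?thesis
      by (cases rule: simulates.cases) (use v m(2) in \<open>auto simp: step_S valid_def split: if_splits\<close>)
  qed
  with r obtain k where k: "k \<le> 1 + m * (6 * n + 3 * T + 20)"
    "fst ((step S ^^ Suc k) (init S w)) = (if w \<in> A then Acc else Rej)"
    unfolding reach_def by auto
  \<comment> \<open>As m and n are at most T, the total is at most 2 + T (9 T + 20); the factor 40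
    is a generous way to write this as a multiple of (T + 1)^2.\<close>
  have "n \<le> T" using X(1) by (simp add: n_def T_def)
  then have "m * (6 * n + 3 * T + 20) \<le> T * (9 * T + 20)" using m(1) by (intro mult_le_mono) auto
  then have "Suc k \<le> 2 + T * (9 * T + 20)" using k(1) by simp
  also have "\<dots> \<le> 40 * (T + 1) * (T + 1)" by (simp add: algebra_simps)
  also have "\<dots> \<le> t (length w)" using X(3) by (simp add: T_def)
  finally show "\<exists>m\<le>t (length w). fst ((step S ^^ m) (init S w)) = (if w \<in> A then accept S else reject S)"
    using k(2) by (intro exI[of _ "Suc k"]) (simp add: S_def del: funpow.simps)
qed

end

theorem theorem4p7:
  fixes \<alpha> :: cnf and A :: "'a::finite list set" and B :: "'b::finite list set"
  assumes "normal \<alpha>" and "fin 3 \<le> \<alpha>"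
    and "turing_red_class (grz_below \<alpha>) A B"
    and "B \<in> FF \<alpha>"
  shows "A \<in> FF \<alpha>"
proof -
  obtain f and M :: "('a, 'b, nat, nat) otm" where f: "f \<in> grz_below \<alpha>" "wf_otm M"
    "\<And>w. \<exists>m\<le>f (length w). fst ((ostep B M ^^ m) (init M w)) = (if w \<in> A then accept M else reject M)"
    using assms(3) unfolding turing_red_class_def turing_red_def by blast
  obtain p and N :: "('b, nat, nat) tm" where p: "p \<in> grz_below \<alpha>" "wf_tm N"
    "\<And>w. \<exists>m\<le>F \<alpha> (p (length w)). fst ((step N ^^ m) (init N w)) = (if w \<in> B then accept N else reject N)"
    using assms(4) unfolding FF_def DTime_def by blast
  obtain r X where r: "r \<in> grz_below \<alpha>" "\<And>n. f n \<le> X n" "\<And>n j. j \<le> f n \<Longrightarrow> F \<alpha> (p j) \<le> X n"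
    "\<And>n. 40 * (X n + 1) * (X n + 1) \<le> F \<alpha> (r n)"
    using polynomial_overhead[OF assms(1,2) f(1) p(1), of 40] by blast
  interpret reduction M N using f(2) p(2) by unfold_locales
  have "A \<in> DTime (\<lambda>n. F \<alpha> (r n))"
    by (rule reduction_DTime[where u = "\<lambda>j. F \<alpha> (p j)", OF p(3) f(3) r(2-4)])
  then show ?thesis using r(1) unfolding FF_def by blast
qed

end
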